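(* Let $\mathcal{V}=(V,K)$ be a vector space in the two-sorted language $\mathrm{L}$ (or $\mathrm{L}_{W,\lambda}$, or any other interpretable language). Then $\mathcal{V}$ is NIP if and only if $K$ is NIP.
   Context: $\mathrm{L}=\{V,+,0\}\cup\{K,+,\cdot,0,1\}\cup\{\mathrm{scal}:K\times V\to V\}$ is the two-sorted language of vector spaces over a non-fixed field $K$, where $\mathrm{scal}$ is scalar multiplication. $K$ is considered as a pure field. $\mathrm{L}_{W,\lambda}=\mathrm{L}\cup\{W_n\subset V^n\}_n\cup\{\lambda_{n,i}:V^{n+1}\to K\}_{1\le i\le n}$, where $W_n$ is the set of $K$-linearly independent $n$-tuples of vectors, and $\lambda_{n,i}(v,v_1,\dots,v_n)=\lambda_i$ if $W_n(v_1,\dots,v_n)$ and $v=\sum_{i}\lambda_iv_i$, and $=0$ if $v_1,\dots,v_n$ are linearly dependent or $v,v_1,\dots,v_n$ are linearly independent. These symbols are definable in $\mathrm{L}$. *)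

theory Defs
  imports Complex_Main
begin

section \<open>Many-sorted first-order logic\<close>

text \<open>
  Sorts, function symbols and relation symbols are drawn from the types 's, 'f and 'r.  An element
  of 'f or 'r to which the signature assigns None is not a symbol of the language; this is how a
  language without relation symbols is written.  All sorts of a structure live in one type 'a.
  Their carriers may overlap, which no well-sorted formula can detect, since equality is only
  allowed between terms of the same sort.
\<close>

record ('s, 'f, 'r) language =
  fsig :: "'f \<Rightarrow> ('s list \<times> 's) option"
  rsig :: "'r \<Rightarrow> 's list option"

record ('s, 'f, 'r, 'a) struc =
  carrier :: "'s \<Rightarrow> 'a set"
  fint :: "'f \<Rightarrow> 'a list \<Rightarrow> 'a"
  rint :: "'r \<Rightarrow> 'a list \<Rightarrow> bool"

definition tuples :: "('s, 'f, 'r, 'a) struc \<Rightarrow> 's list \<Rightarrow> 'a list set" where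
  "tuples M ss = {as. list_all2 (\<lambda>a s. a \<in> carrier M s) as ss}"

definition is_structure :: "('s, 'f, 'r) language \<Rightarrow> ('s, 'f, 'r, 'a) struc \<Rightarrow> bool" where
  "is_structure L M \<longleftrightarrow>
     (\<forall>s. carrier M s \<noteq> {}) \<and>
     (\<forall>f ss s. fsig L f = Some (ss, s) \<longrightarrow> (\<forall>as \<in> tuples M ss. fint M f as \<in> carrier M s))"

type_synonym 's var = "'s \<times> nat"

datatype ('s, 'f) tm = Var "'s var" | App 'f "('s, 'f) tm list"

datatype ('s, 'f, 'r) fm =
    Eq "('s, 'f) tm" "('s, 'f) tm"
  | Rel 'r "('s, 'f) tm list"
  | Neg "('s, 'f, 'r) fm"
  | Conj "('s, 'f, 'r) fm" "('s, 'f, 'r) fm"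
  | Ex "'s var" "('s, 'f, 'r) fm"

inductive wf_tm :: "('s, 'f, 'r) language \<Rightarrow> ('s, 'f) tm \<Rightarrow> 's \<Rightarrow> bool" for L where
  "wf_tm L (Var (s, n)) s"
| "fsig L f = Some (ss, s) \<Longrightarrow> list_all2 (wf_tm L) ts ss \<Longrightarrow> wf_tm L (App f ts) s"

primrec wf_fm :: "('s, 'f, 'r) language \<Rightarrow> ('s, 'f, 'r) fm \<Rightarrow> bool" where
  "wf_fm L (Eq t u) \<longleftrightarrow> (\<exists>s. wf_tm L t s \<and> wf_tm L u s)"
| "wf_fm L (Rel r ts) \<longleftrightarrow> (\<exists>ss. rsig L r = Some ss \<and> list_all2 (wf_tm L) ts ss)"
| "wf_fm L (Neg \<phi>) \<longleftrightarrow> wf_fm L \<phi>"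
| "wf_fm L (Conj \<phi> \<psi>) \<longleftrightarrow> wf_fm L \<phi> \<and> wf_fm L \<psi>"
| "wf_fm L (Ex v \<phi>) \<longleftrightarrow> wf_fm L \<phi>"

definition valuations :: "('s, 'f, 'r, 'a) struc \<Rightarrow> ('s var \<Rightarrow> 'a) set" where
  "valuations M = {e. \<forall>s n. e (s, n) \<in> carrier M s}"

primrec tm_val :: "('s, 'f, 'r, 'a) struc \<Rightarrow> ('s var \<Rightarrow> 'a) \<Rightarrow> ('s, 'f) tm \<Rightarrow> 'a" where
  "tm_val M e (Var v) = e v"
| "tm_val M e (App f ts) = fint M f (map (tm_val M e) ts)"

primrec sat :: "('s, 'f, 'r, 'a) struc \<Rightarrow> ('s var \<Rightarrow> 'a) \<Rightarrow> ('s, 'f, 'r) fm \<Rightarrow> bool" where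
  "sat M e (Eq t u) \<longleftrightarrow> tm_val M e t = tm_val M e u"
| "sat M e (Rel r ts) \<longleftrightarrow> rint M r (map (tm_val M e) ts)"
| "sat M e (Neg \<phi>) \<longleftrightarrow> \<not> sat M e \<phi>"
| "sat M e (Conj \<phi> \<psi>) \<longleftrightarrow> sat M e \<phi> \<and> sat M e \<psi>"
| "sat M e (Ex v \<phi>) \<longleftrightarrow> (\<exists>a \<in> carrier M (fst v). sat M (e(v := a)) \<phi>)"


section \<open>NIP\<close>

text \<open>
  A set X of variables turns a formula into a partitioned formula \<open>\<phi>(x; y)\<close>: the tuple x consists
  of the free variables of \<open>\<phi>\<close> in X, the tuple y of the remaining ones.  Tuples are given by
  valuations, so \<open>\<phi>(a; b)\<close> is evaluated under the valuation that is a on X and b elsewhere; only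
  the finitely many free variables matter.

  The formula has the independence property if it shatters arbitrarily large finite sets of
  tuples, i.e. if its VC dimension is infinite.  This is a property of the theory of M: by
  compactness it holds iff \<open>\<phi>\<close> shatters an infinite set in some elementary extension of M.
\<close>

definition has_IP :: "('s, 'f, 'r, 'a) struc \<Rightarrow> 's var set \<Rightarrow> ('s, 'f, 'r) fm \<Rightarrow> bool" where
  "has_IP M X \<phi> \<longleftrightarrow>
     (\<forall>n::nat. \<exists>(a :: nat \<Rightarrow> 's var \<Rightarrow> 'a) (b :: nat set \<Rightarrow> 's var \<Rightarrow> 'a).
        (\<forall>i<n. a i \<in> valuations M) \<and>
        (\<forall>I. I \<subseteq> {..<n} \<longrightarrow> b I \<in> valuations M) \<and>
        (\<forall>i<n. \<forall>I. I \<subseteq> {..<n} \<longrightarrow> (sat M (override_on (b I) (a i) X) \<phi> \<longleftrightarrow> i \<in> I)))"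

definition nip :: "('s, 'f, 'r) language \<Rightarrow> ('s, 'f, 'r, 'a) struc \<Rightarrow> bool" where
  "nip L M \<longleftrightarrow> (\<forall>\<phi> X. wf_fm L \<phi> \<longrightarrow> \<not> has_IP M X \<phi>)"


section \<open>Interpretations\<close>

text \<open>
  In a formula defining a set of tuples of sorts ss, the i-th coordinate is the value of the
  variable (ss ! i, i).  The values of all other variables act as parameters.
\<close>

definition assign :: "'s list \<Rightarrow> 'a list \<Rightarrow> ('s var \<Rightarrow> 'a) \<Rightarrow> 's var \<Rightarrow> 'a" where
  "assign ss as e = (\<lambda>(s, n). if n < length ss \<and> ss ! n = s then as ! n else e (s, n))"

definition definable ::
    "('s, 'f, 'r) language \<Rightarrow> ('s, 'f, 'r, 'a) struc \<Rightarrow> 's list \<Rightarrow> 'a list set \<Rightarrow> bool" where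
  "definable L M ss S \<longleftrightarrow>
     (\<exists>\<phi> e. wf_fm L \<phi> \<and> e \<in> valuations M \<and> S = {as \<in> tuples M ss. sat M (assign ss as e) \<phi>})"

text \<open>
  N is interpretable in M, with parameters: each sort t of N is the quotient, under the
  coordinate map h t, of a definable set D t of tuples of sorts dm t, and the pullbacks of
  equality, of the graphs of the function symbols and of the relation symbols are definable.
\<close>

definition interpretable_in ::
    "('t, 'g, 'q) language \<Rightarrow> ('t, 'g, 'q, 'b) struc \<Rightarrow>
     ('s, 'f, 'r) language \<Rightarrow> ('s, 'f, 'r, 'a) struc \<Rightarrow> bool" where
  "interpretable_in L' N L M \<longleftrightarrow>
     (\<exists>(dm :: 't \<Rightarrow> 's list) (D :: 't \<Rightarrow> 'a list set) (h :: 't \<Rightarrow> 'a list \<Rightarrow> 'b).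
        (\<forall>t. definable L M (dm t) (D t) \<and> h t ` D t = carrier N t \<and>
             definable L M (dm t @ dm t) {x @ y | x y. x \<in> D t \<and> y \<in> D t \<and> h t x = h t y}) \<and>
        (\<forall>f ts t. fsig L' f = Some (ts, t) \<longrightarrow>
             definable L M (concat (map dm ts) @ dm t)
               {concat xs @ y | xs y. list_all2 (\<lambda>x u. x \<in> D u) xs ts \<and> y \<in> D t \<and>
                                      fint N f (map2 h ts xs) = h t y}) \<and>
        (\<forall>r ts. rsig L' r = Some ts \<longrightarrow>
             definable L M (concat (map dm ts))
               {concat xs | xs. list_all2 (\<lambda>x u. x \<in> D u) xs ts \<and> rint N r (map2 h ts xs)}))"

definition mutually_interpretable ::
    "('t, 'g, 'q) language \<Rightarrow> ('t, 'g, 'q, 'b) struc \<Rightarrow>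
     ('s, 'f, 'r) language \<Rightarrow> ('s, 'f, 'r, 'a) struc \<Rightarrow> bool" where
  "mutually_interpretable L' N L M \<longleftrightarrow> interpretable_in L' N L M \<and> interpretable_in L M L' N"


section \<open>Fields and vector spaces as structures\<close>

datatype field_fun = FAdd | FMul | FZero | FOne

primrec field_arity :: "field_fun \<Rightarrow> nat" where
  "field_arity FAdd = 2"
| "field_arity FMul = 2"
| "field_arity FZero = 0"
| "field_arity FOne = 0"

primrec field_op :: "field_fun \<Rightarrow> 'k::field list \<Rightarrow> 'k" where
  "field_op FAdd xs = xs ! 0 + xs ! 1"
| "field_op FMul xs = xs ! 0 * xs ! 1"
| "field_op FZero xs = 0"
| "field_op FOne xs = 1"

definition field_lang :: "(unit, field_fun, unit) language" where
  "field_lang = \<lparr>fsig = (\<lambda>f. Some (replicate (field_arity f) (), ())), rsig = (\<lambda>_. None)\<rparr>"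

definition field_struct :: "(unit, field_fun, unit, 'k::field) struc" where
  "field_struct = \<lparr>carrier = (\<lambda>_. UNIV), fint = field_op, rint = (\<lambda>_ _. False)\<rparr>"

datatype vs_sort = Vec | Sca

datatype vs_fun = VAdd | VZero | Scal | Fld field_fun

primrec vs_fsig :: "vs_fun \<Rightarrow> vs_sort list \<times> vs_sort" where
  "vs_fsig VAdd = ([Vec, Vec], Vec)"
| "vs_fsig VZero = ([], Vec)"
| "vs_fsig Scal = ([Sca, Vec], Vec)"
| "vs_fsig (Fld f) = (replicate (field_arity f) Sca, Sca)"

definition vs_lang :: "(vs_sort, vs_fun, unit) language" where
  "vs_lang = \<lparr>fsig = (\<lambda>f. Some (vs_fsig f)), rsig = (\<lambda>_. None)\<rparr>"

primrec vs_carrier :: "vs_sort \<Rightarrow> ('v + 'k) set" where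
  "vs_carrier Vec = range Inl"
| "vs_carrier Sca = range Inr"

primrec vs_op ::
    "('k::field \<Rightarrow> 'v::ab_group_add \<Rightarrow> 'v) \<Rightarrow> vs_fun \<Rightarrow> ('v + 'k) list \<Rightarrow> 'v + 'k" where
  "vs_op scale VAdd xs = Inl (projl (xs ! 0) + projl (xs ! 1))"
| "vs_op scale VZero xs = Inl 0"
| "vs_op scale Scal xs = Inl (scale (projr (xs ! 0)) (projl (xs ! 1)))"
| "vs_op scale (Fld f) xs = Inr (field_op f (map projr xs))"

definition vs_struct ::
    "('k::field \<Rightarrow> 'v::ab_group_add \<Rightarrow> 'v) \<Rightarrow> (vs_sort, vs_fun, unit, 'v + 'k) struc" where
  "vs_struct scale = \<lparr>carrier = vs_carrier, fint = vs_op scale, rint = (\<lambda>_ _. False)\<rparr>"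

definition lin_indep_tuple :: "('k::field \<Rightarrow> 'v::ab_group_add \<Rightarrow> 'v) \<Rightarrow> 'v list \<Rightarrow> bool" where
  "lin_indep_tuple scale vs \<longleftrightarrow> distinct vs \<and> \<not> module.dependent scale (set vs)"

text \<open>
  The value of \<open>\<lambda>\<^sub>n\<^sub>,\<^sub>i(v, v\<^sub>1, \<dots>, v\<^sub>n)\<close> for vs the list of \<open>v\<^sub>1, \<dots>, v\<^sub>n\<close>.  The index i counts from 1,
  list positions from 0.  The library's representation is 0 for v outside the span of vs.
\<close>

definition coord :: "('k::field \<Rightarrow> 'v::ab_group_add \<Rightarrow> 'v) \<Rightarrow> nat \<Rightarrow> 'v \<Rightarrow> 'v list \<Rightarrow> 'k" where
  "coord scale i v vs =
     (if lin_indep_tuple scale vs then module.representation scale (set vs) v (vs ! (i - 1)) else 0)"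

datatype vsW_fun = Base vs_fun | Lambda nat nat
datatype vsW_rel = W nat

primrec vsW_fsig :: "vsW_fun \<Rightarrow> (vs_sort list \<times> vs_sort) option" where
  "vsW_fsig (Base f) = Some (vs_fsig f)"
| "vsW_fsig (Lambda n i) =
     (if 1 \<le> i \<and> i \<le> n then Some (replicate (Suc n) Vec, Sca) else None)"

primrec vsW_rsig :: "vsW_rel \<Rightarrow> vs_sort list option" where
  "vsW_rsig (W n) = Some (replicate n Vec)"

definition vsW_lang :: "(vs_sort, vsW_fun, vsW_rel) language" where
  "vsW_lang = \<lparr>fsig = vsW_fsig, rsig = vsW_rsig\<rparr>"

primrec vsW_op ::
    "('k::field \<Rightarrow> 'v::ab_group_add \<Rightarrow> 'v) \<Rightarrow> vsW_fun \<Rightarrow> ('v + 'k) list \<Rightarrow> 'v + 'k" where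
  "vsW_op scale (Base f) xs = vs_op scale f xs"
| "vsW_op scale (Lambda n i) xs = Inr (coord scale i (projl (hd xs)) (map projl (tl xs)))"

definition vsW_struct ::
    "('k::field \<Rightarrow> 'v::ab_group_add \<Rightarrow> 'v) \<Rightarrow> (vs_sort, vsW_fun, vsW_rel, 'v + 'k) struc" where
  "vsW_struct scale =
     \<lparr>carrier = vs_carrier, fint = vsW_op scale,
      rint = (\<lambda>_ xs. lin_indep_tuple scale (map projl xs))\<rparr>"

end

theory Submission
  imports Defs "HOL-Library.Nat_Bijection"
begin

text \<open>
  Fix a formula and a frame of d independent vectors.  At vectors in the span of the frame, the
  formula becomes a field formula in the coordinates, depending on d only.  The difficulty is
  that a shattered family of tuples a i, b I has no common finite frame.  By induction on dimension
  one may assume that the a i span subspaces independent over a common space E of bounded dimension;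
  then each b I is independent over E from all a i with boundedly many exceptions.  For the other i
  the coordinates of a i and of b I with respect to E and to separate complements may be chosen
  independently of each other, so a field formula shatters the a i up to a bounded number of errors,
  hence shatters arbitrarily large sets exactly.  Everything else follows because NIP passes to
  interpretable structures.
\<close>

text \<open>The field formula is built separately for each d: an equation of vectors becomes d
  equations of scalars, and a vector quantifier becomes a block of d scalar quantifiers together
  with, if the dimension permits, a passage to d + 1. So all frames in use must have bounded length.
  Apart from its length the frame is immaterial, since the translation reads coordinates only; this
  is what allows a different frame for each pair (i, I) in one shattered family. The frame of a pair
  consists of vectors for i, a basis of E, and vectors added by b I. Let q be the number of vector
  variables in y. It bounds the vectors added by b I, so that only q + 1 lengths occur, and, by a
  dimension count, the exceptional i for each I. As the length varies with I, a family of fixed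
  length has to be extracted while the errors are removed; both together produce the factor (q + 1)
  * (q + 1). Definability is taken with parameters throughout: in the independence property they are
  absorbed into the tuples b I.\<close>

declare split_paired_All [simp del] split_paired_Ex [simp del]

section \<open>First-order definability with parameters\<close>

section \<open>Renaming variables\<close>

primrec tm_vars :: "('s, 'f) tm \<Rightarrow> 's var set" where
  "tm_vars (Var v) = {v}"
| "tm_vars (App f ts) = \<Union> (set (map tm_vars ts))"

primrec fm_vars :: "('s, 'f, 'r) fm \<Rightarrow> 's var set" where
  "fm_vars (Eq t u) = tm_vars t \<union> tm_vars u"
| "fm_vars (Rel r ts) = \<Union> (set (map tm_vars ts))"
| "fm_vars (Neg \<phi>) = fm_vars \<phi>"
| "fm_vars (Conj \<phi> \<psi>) = fm_vars \<phi> \<union> fm_vars \<psi>"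
| "fm_vars (Ex v \<phi>) = fm_vars \<phi> - {v}"

primrec ren_tm :: "('s var \<Rightarrow> 's var) \<Rightarrow> ('s, 'f) tm \<Rightarrow> ('s, 'f) tm" where
  "ren_tm \<rho> (Var v) = Var (\<rho> v)"
| "ren_tm \<rho> (App f ts) = App f (map (ren_tm \<rho>) ts)"

lemma finite_tm_vars: "finite (tm_vars t)"
  by (induction t) auto

lemma finite_fm_vars: "finite (fm_vars \<phi>)"
  by (induction \<phi>) (auto simp: finite_tm_vars)

lemma tm_val_cong:
  assumes "\<And>v. v \<in> tm_vars t \<Longrightarrow> e v = e' v"
  shows "tm_val M e t = tm_val M e' t"
  using assms
proof (induction t)
  case (App f ts)
  then have "map (tm_val M e) ts = map (tm_val M e') ts"
    by (intro map_cong) auto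
  then show ?case by (simp only: tm_val.simps)
qed simp

lemma sat_cong:
  assumes "\<And>v. v \<in> fm_vars \<phi> \<Longrightarrow> e v = e' v"
  shows "sat M e \<phi> \<longleftrightarrow> sat M e' \<phi>"
  using assms
proof (induction \<phi> arbitrary: e e')
  case (Eq t u)
  then show ?case
    using tm_val_cong[of t e e' M] tm_val_cong[of u e e' M] by simp
next
  case (Rel r ts)
  have "map (tm_val M e) ts = map (tm_val M e') ts"
    by (intro map_cong refl tm_val_cong Rel.prems) auto
  then show ?case by (simp only: sat.simps)
next
  case (Conj \<phi> \<psi>)
  have "sat M e \<phi> = sat M e' \<phi>"
    by (rule Conj.IH) (simp add: Conj.prems)
  moreover have "sat M e \<psi> = sat M e' \<psi>"
    by (rule Conj.IH) (simp add: Conj.prems)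
  ultimately show ?case by simp
next
  case (Ex v \<phi>)
  have "sat M (e(v := a)) \<phi> \<longleftrightarrow> sat M (e'(v := a)) \<phi>" for a
    by (rule Ex.IH) (use Ex.prems in auto)
  then show ?case by simp
next
  case (Neg \<phi>)
  have "sat M e \<phi> = sat M e' \<phi>"
    by (rule Neg.IH) (simp add: Neg.prems)
  then show ?case by simp
qed

lemma tm_val_ren: "tm_val M e (ren_tm \<rho> t) = tm_val M (\<lambda>v. e (\<rho> v)) t"
proof (induction t)
  case (App f ts)
  then have "map (tm_val M e \<circ> ren_tm \<rho>) ts = map (tm_val M (\<lambda>v. e (\<rho> v))) ts"
    by (intro map_cong) auto
  then show ?case by (simp only: tm_val.simps ren_tm.simps map_map)
qed simp

lemma wf_tm_ren:
  assumes "wf_tm L t s" and "fst \<circ> \<rho> = fst"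
  shows "wf_tm L (ren_tm \<rho> t) s"
  using assms(1)
proof (induction)
  case (1 s n)
  then show ?case using fun_cong[OF assms(2), of "(s, n)"]
    by (cases "\<rho> (s, n)") (auto intro: wf_tm.intros)
next
  case (2 f ss s ts)
  then show ?case by (auto intro!: wf_tm.intros(2) simp: list_all2_conv_all_nth)
qed

text \<open>\<open>\<rho>\<close> need not be injective: identifying free variables is harmless, and
  \<open>dfn_ex\<close> relies on it to merge variables. Only capture has to be avoided, which is
  why the induction varies \<open>\<rho>\<close> and redirects it at each bound variable.\<close>

lemma ex_rename:
  assumes "wf_fm L \<phi>" and "fst \<circ> \<rho> = fst"
  shows "\<exists>\<psi>. wf_fm L \<psi> \<and> (\<forall>e. sat M e \<psi> \<longleftrightarrow> sat M (\<lambda>v. e (\<rho> v)) \<phi>)"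
  using assms
proof (induction \<phi> arbitrary: \<rho>)
  case (Eq t u)
  then obtain s where "wf_tm L t s" "wf_tm L u s" by auto
  then have "wf_tm L (ren_tm \<rho> t) s" "wf_tm L (ren_tm \<rho> u) s"
    using Eq.prems(2) by (blast intro: wf_tm_ren)+
  then show ?case
    by (intro exI[of _ "Eq (ren_tm \<rho> t) (ren_tm \<rho> u)"]) (auto simp: tm_val_ren)
next
  case (Rel r ts)
  have *: "map (tm_val M e \<circ> ren_tm \<rho>) ts = map (tm_val M (\<lambda>v. e (\<rho> v))) ts" for e
    by (auto simp: tm_val_ren)
  from Rel.prems obtain ss where ss: "rsig L r = Some ss" "list_all2 (wf_tm L) ts ss" by auto
  have "list_all2 (wf_tm L) (map (ren_tm \<rho>) ts) ss"
    unfolding list_all2_map1 by (rule list_all2_mono[OF ss(2)]) (rule wf_tm_ren[OF _ Rel.prems(2)])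
  then show ?case
    using ss(1) by (intro exI[of _ "Rel r (map (ren_tm \<rho>) ts)"]) (simp add: *)
next
  case (Neg \<phi>)
  then obtain \<psi> where "wf_fm L \<psi>" "\<forall>e. sat M e \<psi> \<longleftrightarrow> sat M (\<lambda>v. e (\<rho> v)) \<phi>"
    using Neg.IH[of \<rho>] Neg.prems by auto
  then show ?case by (intro exI[of _ "Neg \<psi>"]) auto
next
  case (Conj \<phi>1 \<phi>2)
  obtain \<psi>1 where "wf_fm L \<psi>1" "\<forall>e. sat M e \<psi>1 \<longleftrightarrow> sat M (\<lambda>v. e (\<rho> v)) \<phi>1"
    using Conj.IH(1)[of \<rho>] Conj.prems by auto
  moreover obtain \<psi>2 where "wf_fm L \<psi>2" "\<forall>e. sat M e \<psi>2 \<longleftrightarrow> sat M (\<lambda>v. e (\<rho> v)) \<phi>2"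
    using Conj.IH(2)[of \<rho>] Conj.prems by auto
  ultimately show ?case by (intro exI[of _ "Conj \<psi>1 \<psi>2"]) auto
next
  case (Ex v \<phi>)
  have "finite (snd ` \<rho> ` fm_vars \<phi>)" by (simp add: finite_fm_vars)
  \<comment> \<open>The new bound variable gets an index that no renamed free variable has, so
    nothing is captured.\<close>
  then obtain k where k: "k \<notin> snd ` \<rho> ` fm_vars \<phi>"
    using ex_new_if_finite infinite_UNIV_nat by blast
  define v' where "v' = (fst v, k)"
  have "wf_fm L \<phi>" using Ex by simp
  moreover have "fst \<circ> \<rho>(v := v') = fst"
    using Ex.prems(2) by (simp add: v'_def fun_eq_iff)
  ultimately obtain \<psi> where \<psi>: "wf_fm L \<psi>"
    "\<And>e. sat M e \<psi> \<longleftrightarrow> sat M (\<lambda>w. e ((\<rho>(v := v')) w)) \<phi>"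
    using Ex.IH[of "\<rho>(v := v')"] by blast
  have "sat M (e(v' := a)) \<psi> \<longleftrightarrow> sat M ((\<lambda>w. e (\<rho> w))(v := a)) \<phi>" for e a
    unfolding \<psi>(2) by (rule sat_cong) (use k in \<open>force simp: v'_def image_iff\<close>)
  then show ?case
    using \<psi>(1) by (intro exI[of _ "Ex v' \<psi>"]) (auto simp: v'_def)
qed

section \<open>Definable predicates over arbitrary variable types\<close>

text \<open>
  A predicate on assignments of a type 'x of sorted variables counts as definable if it is the
  pullback of a formula along a map sending each variable of the formula either to some x or to a
  parameter.  Substitution is then mere composition of maps.
\<close>

definition vals :: "('s, 'f, 'r, 'a) struc \<Rightarrow> ('x \<Rightarrow> 's) \<Rightarrow> ('x \<Rightarrow> 'a) set" where
  "vals M \<sigma> = {e. \<forall>x. e x \<in> carrier M (\<sigma> x)}"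

definition pull :: "('x \<Rightarrow> 'a) \<Rightarrow> ('v \<Rightarrow> 'x + 'a) \<Rightarrow> 'v \<Rightarrow> 'a" where
  "pull e g v = (case g v of Inl x \<Rightarrow> e x | Inr a \<Rightarrow> a)"

definition sorted_subst ::
    "('s, 'f, 'r, 'a) struc \<Rightarrow> ('v \<Rightarrow> 's) \<Rightarrow> ('x \<Rightarrow> 's) \<Rightarrow> ('v \<Rightarrow> 'x + 'a) \<Rightarrow> bool" where
  "sorted_subst M \<tau> \<sigma> g \<longleftrightarrow>
     (\<forall>v. case g v of Inl x \<Rightarrow> \<sigma> x = \<tau> v | Inr a \<Rightarrow> a \<in> carrier M (\<tau> v))"

definition dfn ::
    "('s, 'f, 'r) language \<Rightarrow> ('s, 'f, 'r, 'a) struc \<Rightarrow> ('x \<Rightarrow> 's) \<Rightarrow> (('x \<Rightarrow> 'a) \<Rightarrow> bool) \<Rightarrow> bool" where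
  "dfn L M \<sigma> P \<longleftrightarrow>
     (\<exists>\<phi> g. wf_fm L \<phi> \<and> sorted_subst M fst \<sigma> g \<and> (\<forall>e \<in> vals M \<sigma>. P e \<longleftrightarrow> sat M (pull e g) \<phi>))"

lemma sorted_substD:
  assumes "sorted_subst M \<tau> \<sigma> g"
  shows "g v = Inl x \<Longrightarrow> \<sigma> x = \<tau> v" and "g v = Inr a \<Longrightarrow> a \<in> carrier M (\<tau> v)"
  using assms unfolding sorted_subst_def by (metis sum.case(1), metis sum.case(2))

lemma sorted_substI:
  assumes "\<And>v x. g v = Inl x \<Longrightarrow> \<sigma> x = \<tau> v" and "\<And>v a. g v = Inr a \<Longrightarrow> a \<in> carrier M (\<tau> v)"
  shows "sorted_subst M \<tau> \<sigma> g"
  using assms unfolding sorted_subst_def by (simp split: sum.split)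

lemma pull_vals:
  assumes "sorted_subst M \<tau> \<sigma> g" and "e \<in> vals M \<sigma>"
  shows "pull e g \<in> vals M \<tau>"
proof -
  have "pull e g v \<in> carrier M (\<tau> v)" for v
  proof (cases "g v")
    case (Inl x)
    then show ?thesis
      using sorted_substD(1)[OF assms(1) Inl] assms(2) by (simp add: pull_def vals_def) metis
  next
    case (Inr a)
    then show ?thesis using sorted_substD(2)[OF assms(1) Inr] by (simp add: pull_def)
  qed
  then show ?thesis by (simp add: vals_def)
qed

lemma vals_fst: "vals M fst = valuations M"
  by (simp add: vals_def valuations_def split_paired_All)

lemma override_vals: "e \<in> vals M \<sigma> \<Longrightarrow> f \<in> vals M \<sigma> \<Longrightarrow> override_on e f A \<in> vals M \<sigma>"
  by (auto simp: vals_def override_on_def)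

lemma dfn_cong:
  assumes "dfn L M \<sigma> P" and "\<And>e. e \<in> vals M \<sigma> \<Longrightarrow> P e \<longleftrightarrow> Q e"
  shows "dfn L M \<sigma> Q"
  using assms unfolding dfn_def by (metis (no_types, lifting))

lemma dfn_subst:
  assumes "dfn L M \<tau> P" and r: "sorted_subst M \<tau> \<sigma> r"
  shows "dfn L M \<sigma> (\<lambda>e. P (pull e r))"
proof -
  obtain \<phi> g where \<phi>: "wf_fm L \<phi>" "sorted_subst M fst \<tau> g"
    "\<And>e. e \<in> vals M \<tau> \<Longrightarrow> P e \<longleftrightarrow> sat M (pull e g) \<phi>"
    using assms(1) unfolding dfn_def by blast
  define g' where "g' v = (case g v of Inl x \<Rightarrow> r x | Inr a \<Rightarrow> Inr a)" for v
  have "sorted_subst M fst \<sigma> g'"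
    using sorted_substD[OF \<phi>(2)] sorted_substD[OF r]
    by (intro sorted_substI) (auto simp: g'_def split: sum.splits, metis+)
  moreover have "pull (pull e r) g = pull e g'" for e
    by (auto simp: pull_def g'_def fun_eq_iff split: sum.splits)
  ultimately show ?thesis
    using \<phi>(1,3) pull_vals[OF r] unfolding dfn_def by metis
qed

lemma dfn_neg: "dfn L M \<sigma> P \<Longrightarrow> dfn L M \<sigma> (\<lambda>e. \<not> P e)"
  unfolding dfn_def by (metis sat.simps(3) wf_fm.simps(3))

text \<open>The two formulas may use the same variable for different arguments or parameters. Moving
  one to even and the other to odd indices lets a single map \<open>h\<close> serve both.\<close>

lemma dfn_conj:
  assumes "dfn L M \<sigma> P" and "dfn L M \<sigma> Q"
  shows "dfn L M \<sigma> (\<lambda>e. P e \<and> Q e)"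
proof -
  obtain \<phi> g where \<phi>: "wf_fm L \<phi>" "sorted_subst M fst \<sigma> g"
    "\<And>e. e \<in> vals M \<sigma> \<Longrightarrow> P e \<longleftrightarrow> sat M (pull e g) \<phi>"
    using assms(1) unfolding dfn_def by blast
  obtain \<psi> k where \<psi>: "wf_fm L \<psi>" "sorted_subst M fst \<sigma> k"
    "\<And>e. e \<in> vals M \<sigma> \<Longrightarrow> Q e \<longleftrightarrow> sat M (pull e k) \<psi>"
    using assms(2) unfolding dfn_def by blast
  obtain \<phi>' where \<phi>': "wf_fm L \<phi>'" "\<And>e. sat M e \<phi>' \<longleftrightarrow> sat M (\<lambda>v. e (fst v, 2 * snd v)) \<phi>"
    using ex_rename[OF \<phi>(1), of "\<lambda>v. (fst v, 2 * snd v)" M] by (auto simp: fun_eq_iff)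
  obtain \<psi>' where \<psi>': "wf_fm L \<psi>'" "\<And>e. sat M e \<psi>' \<longleftrightarrow> sat M (\<lambda>v. e (fst v, Suc (2 * snd v))) \<psi>"
    using ex_rename[OF \<psi>(1), of "\<lambda>v. (fst v, Suc (2 * snd v))" M] by (auto simp: fun_eq_iff)
  define h where
    "h v = (if even (snd v) then g (fst v, snd v div 2) else k (fst v, snd v div 2))" for v
  have "sorted_subst M fst \<sigma> h"
    using sorted_substD[OF \<phi>(2)] sorted_substD[OF \<psi>(2)]
    by (intro sorted_substI) (fastforce simp: h_def split: if_splits)+
  moreover have "(\<lambda>v. pull e h (fst v, 2 * snd v)) = pull e g"
    "(\<lambda>v. pull e h (fst v, Suc (2 * snd v))) = pull e k" for e
    by (auto simp: pull_def h_def fun_eq_iff)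
  ultimately show ?thesis
    unfolding dfn_def
    by (intro exI[of _ "Conj \<phi>' \<psi>'"] exI[of _ h]) (simp add: \<phi>' \<psi>' \<phi>(3) \<psi>(3))
qed

lemma dfn_disj: "dfn L M \<sigma> P \<Longrightarrow> dfn L M \<sigma> Q \<Longrightarrow> dfn L M \<sigma> (\<lambda>e. P e \<or> Q e)"
  using dfn_neg[OF dfn_conj[OF dfn_neg[of L M \<sigma> P] dfn_neg[of L M \<sigma> Q]]] by simp

lemma dfn_ex:
  assumes "dfn L M \<sigma> P" and ne: "\<And>s. carrier M s \<noteq> {}"
  shows "dfn L M \<sigma> (\<lambda>e. \<exists>a \<in> carrier M (\<sigma> x). P (e(x := a)))"
proof -
  obtain \<phi> g where \<phi>: "wf_fm L \<phi>" "sorted_subst M fst \<sigma> g"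
    "\<And>e. e \<in> vals M \<sigma> \<Longrightarrow> P e \<longleftrightarrow> sat M (pull e g) \<phi>"
    using assms(1) unfolding dfn_def by blast
  \<comment> \<open>Several variables of \<open>\<phi>\<close> may stand for x. All of them are
    merged into the single variable \<open>(\<sigma> x, 0)\<close>, which is then quantified; the
    shift by one keeps index 0 free for it.\<close>
  define \<rho> where "\<rho> v = (if g v = Inl x then (\<sigma> x, 0) else (fst v, Suc (snd v)))" for v
  have "fst \<circ> \<rho> = fst"
    using sorted_substD(1)[OF \<phi>(2)] by (auto simp: \<rho>_def fun_eq_iff)
  then obtain \<psi> where \<psi>: "wf_fm L \<psi>" "\<And>e. sat M e \<psi> \<longleftrightarrow> sat M (\<lambda>v. e (\<rho> v)) \<phi>"
    using ex_rename[OF \<phi>(1), of \<rho> M] by blast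
  define c where "c s = (SOME a. a \<in> carrier M s)" for s
  have c: "c s \<in> carrier M s" for s
    using ne[of s] by (auto simp: c_def some_in_eq)
  \<comment> \<open>Variables outside the range of \<open>\<rho>\<close> receive a default element
    of their sort; the one at \<open>(\<sigma> x, 0)\<close> is overwritten by the
    quantifier.\<close>
  define h where
    "h v = (if snd v = 0 \<or> g (fst v, snd v - 1) = Inl x then Inr (c (fst v))
            else g (fst v, snd v - 1))" for v
  have "sorted_subst M fst \<sigma> h"
    using sorted_substD[OF \<phi>(2)] c
    by (intro sorted_substI) (fastforce simp: h_def split: if_splits)+
  moreover have "(\<lambda>v. ((pull e h)((\<sigma> x, 0) := a)) (\<rho> v)) = pull (e(x := a)) g" for e a
    by (auto simp: pull_def h_def \<rho>_def fun_eq_iff split: sum.splits)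
  moreover have "e(x := a) \<in> vals M \<sigma>" if "e \<in> vals M \<sigma>" "a \<in> carrier M (\<sigma> x)" for e a
    using that by (auto simp: vals_def)
  ultimately show ?thesis
    unfolding dfn_def using \<psi> \<phi>(3)
    by (intro exI[of _ "Ex (\<sigma> x, 0) \<psi>"] exI[of _ h]) simp
qed

text \<open>A block of quantifiers over the variables in A. The witnesses are packed into one full
  assignment f, of which only the part on A matters; nonempty carriers make such an f exist even for
  empty A.\<close>

lemma dfn_ex_set:
  assumes "finite A" and "dfn L M \<sigma> P" and ne: "\<And>s. carrier M s \<noteq> {}"
  shows "dfn L M \<sigma> (\<lambda>e. \<exists>f \<in> vals M \<sigma>. P (override_on e f A))"
  using assms(1)
proof (induction)
  case empty
  have "(\<lambda>x. SOME a. a \<in> carrier M (\<sigma> x)) \<in> vals M \<sigma>"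
    using ne by (auto simp: vals_def some_in_eq)
  then show ?case using assms(2) by (auto elim!: dfn_cong)
next
  case (insert x A)
  show ?case
  proof (rule dfn_cong[OF dfn_ex[OF insert.IH ne, of x]])
    fix e assume e: "e \<in> vals M \<sigma>"
    have *: "override_on (e(x := f x)) f A = override_on e f (insert x A)" for f
      by (auto simp: override_on_def)
    have "override_on (e(x := a)) f A = override_on (e(x := (f(x := a)) x)) (f(x := a)) A" for f a
      using insert.hyps by (auto simp: override_on_def)
    moreover have "f(x := a) \<in> vals M \<sigma>" if "f \<in> vals M \<sigma>" "a \<in> carrier M (\<sigma> x)" for f a
      using that by (auto simp: vals_def)
    moreover have "f x \<in> carrier M (\<sigma> x)" if "f \<in> vals M \<sigma>" for f
      using that by (auto simp: vals_def)
    ultimately show "(\<exists>a\<in>carrier M (\<sigma> x). \<exists>f\<in>vals M \<sigma>. P (override_on (e(x := a)) f A)) =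
         (\<exists>f\<in>vals M \<sigma>. P (override_on e f (insert x A)))"
      by (metis *)
  qed
qed

lemma dfn_True:
  assumes "\<And>s. carrier M s \<noteq> {}"
  shows "dfn L M \<sigma> (\<lambda>e. True)"
proof -
  let ?c = "\<lambda>s. SOME a. a \<in> carrier M s"
  have "wf_fm L (Eq (Var (s, 0)) (Var (s, 0)))" for s
    by (auto intro: wf_tm.intros)
  then show ?thesis
    using assms unfolding dfn_def
    by (intro exI[of _ "Eq (Var (undefined, 0)) (Var (undefined, 0))"] exI[of _ "\<lambda>v. Inr (?c (fst v))"])
      (auto simp: sorted_subst_def some_in_eq)
qed

lemma dfn_all_finite:
  assumes "finite A" and "\<And>x. x \<in> A \<Longrightarrow> dfn L M \<sigma> (P x)" and ne: "\<And>s. carrier M s \<noteq> {}"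
  shows "dfn L M \<sigma> (\<lambda>e. \<forall>x\<in>A. P x e)"
  using assms(1,2)
proof (induction)
  case empty
  then show ?case by (simp add: dfn_True ne)
next
  case (insert x A)
  then show ?case using dfn_conj[of L M \<sigma> "P x" "\<lambda>e. \<forall>x\<in>A. P x e"] by simp
qed

section \<open>Bounds on shattered families and the transfer of NIP along interpretations\<close>

section \<open>Shattering\<close>

text \<open>The index set J is an arbitrary set of naturals rather than an initial segment, since
  the proofs keep passing to subfamilies of indices.\<close>

definition shatters ::
    "('v \<Rightarrow> 'a) set \<Rightarrow> 'v set \<Rightarrow> (('v \<Rightarrow> 'a) \<Rightarrow> bool) \<Rightarrow> nat set \<Rightarrow>
     (nat \<Rightarrow> 'v \<Rightarrow> 'a) \<Rightarrow> (nat set \<Rightarrow> 'v \<Rightarrow> 'a) \<Rightarrow> bool" where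
  "shatters V X P J a b \<longleftrightarrow>
     (\<forall>i\<in>J. a i \<in> V) \<and> (\<forall>I\<subseteq>J. b I \<in> V) \<and>
     (\<forall>i\<in>J. \<forall>I\<subseteq>J. P (override_on (b I) (a i) X) \<longleftrightarrow> i \<in> I)"

lemma has_IP_iff:
  "has_IP M X \<phi> \<longleftrightarrow> (\<forall>n. \<exists>a b. shatters (valuations M) X (\<lambda>e. sat M e \<phi>) {..<n} a b)"
  by (simp add: has_IP_def shatters_def Ball_def)

lemma shatters_subset: "shatters V X P J a b \<Longrightarrow> J' \<subseteq> J \<Longrightarrow> shatters V X P J' a b"
  unfolding shatters_def by (meson subset_iff subset_trans)

text \<open>NIP survives parameters and a change of variable type: a parameter is constant, so the
  variable holding it can be counted on the side of the tuples b. Reindexing makes the bound n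
  depend on the cardinality of J only.\<close>

lemma nip_dfn_bound:
  assumes "nip L M" and "dfn L M \<sigma> P"
  shows "\<exists>n. \<forall>J a b. finite J \<longrightarrow> n \<le> card J \<longrightarrow> \<not> shatters (vals M \<sigma>) X P J a b"
proof -
  obtain \<phi> g where \<phi>: "wf_fm L \<phi>" "sorted_subst M fst \<sigma> g"
    "\<And>e. e \<in> vals M \<sigma> \<Longrightarrow> P e \<longleftrightarrow> sat M (pull e g) \<phi>"
    using assms(2) unfolding dfn_def by blast
  define X' where "X' = {v. \<exists>x\<in>X. g v = Inl x}"
  have "\<not> has_IP M X' \<phi>" using assms(1) \<phi>(1) by (auto simp: nip_def)
  then obtain n where n: "\<And>a b. \<not> shatters (valuations M) X' (\<lambda>e. sat M e \<phi>) {..<n} a b"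
    by (auto simp: has_IP_iff)
  have False if J: "finite J" "n \<le> card J" and sh: "shatters (vals M \<sigma>) X P J a b" for J a b
  proof -
    obtain J' where J': "J' \<subseteq> J" "card J' = n" using J by (meson obtain_subset_with_card_n)
    then obtain h where h: "bij_betw h {..<n} J'"
      using ex_bij_betw_nat_finite[of J'] J(1) finite_subset by (auto simp: atLeast0LessThan)
    have sh': "shatters (vals M \<sigma>) X P J' a b" using sh J'(1) by (rule shatters_subset)
    have hJ: "h i \<in> J'" if "i < n" for i using h that by (auto simp: bij_betw_def)
    have hI: "h ` I \<subseteq> J'" if "I \<subseteq> {..<n}" for I using hJ that by auto
    have inj: "h i \<in> h ` I \<longleftrightarrow> i \<in> I" if "i < n" "I \<subseteq> {..<n}" for i I
      using h that by (auto simp: bij_betw_def inj_on_def)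
    have ov: "override_on (pull e g) (pull f g) X' = pull (override_on e f X) g" for e f
      by (auto simp: X'_def pull_def override_on_def fun_eq_iff split: sum.splits)
    have v: "pull e g \<in> valuations M" if "e \<in> vals M \<sigma>" for e
      using pull_vals[OF \<phi>(2) that] by (simp add: vals_fst)
    have "shatters (valuations M) X' (\<lambda>e. sat M e \<phi>) {..<n}
            (\<lambda>i. pull (a (h i)) g) (\<lambda>I. pull (b (h ` I)) g)"
      using sh' hJ hI inj v unfolding shatters_def ov
      by (auto simp: \<phi>(3)[symmetric] override_vals)
    then show False using n by blast
  qed
  then show ?thesis by blast
qed

lemma nipI:
  assumes "\<And>\<phi> X. wf_fm L \<phi> \<Longrightarrow>
    \<exists>n. \<forall>a b. \<not> shatters (valuations M) X (\<lambda>e. sat M e \<phi>) {..<n} a b"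
  shows "nip L M"
  using assms by (fastforce simp: nip_def has_IP_iff)

declare split_paired_All [simp] split_paired_Ex [simp]

section \<open>Interpretations transfer NIP\<close>

text \<open>The list xs names the variables that hold the coordinates. It may contain repetitions,
  as happens for the graph of a variable taken at the same variable. All other variables of the
  formula become parameters.\<close>

lemma definable_dfn:
  assumes "definable L M ss S" and "map \<sigma> xs = ss"
  shows "dfn L M \<sigma> (\<lambda>e. map e xs \<in> S)"
proof -
  obtain \<phi> p where \<phi>: "wf_fm L \<phi>" "p \<in> valuations M"
    "S = {as \<in> tuples M ss. sat M (assign ss as p) \<phi>}"
    using assms(1) unfolding definable_def by blast
  define g where
    "g v = (if snd v < length ss \<and> ss ! snd v = fst v then Inl (xs ! snd v) else Inr (p v))" for v
  have "sorted_subst M fst \<sigma> g"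
  proof (rule sorted_substI)
    show "\<sigma> x = fst v" if "g v = Inl x" for v x
      using that assms(2) by (auto simp: g_def split: if_splits)
    show "a \<in> carrier M (fst v)" if "g v = Inr a" for v a
      using that \<phi>(2) by (cases v) (auto simp: g_def valuations_def split: if_splits)
  qed
  moreover have "assign ss (map e xs) p = pull e g" for e
    using assms(2) by (auto simp: assign_def pull_def g_def fun_eq_iff)
  moreover have "map e xs \<in> tuples M ss" if "e \<in> vals M \<sigma>" for e
    using that assms(2) by (auto simp: tuples_def list_all2_conv_all_nth vals_def)
  ultimately show ?thesis
    unfolding dfn_def \<phi>(3) using \<phi>(1) by (intro exI[of _ \<phi>] exI[of _ g]) auto
qed

text \<open>In an interpretation, codes of several elements are concatenated. The sorts determine
  the block lengths, so a concatenation can be cut into blocks in only one way; membership in the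
  definable sets of \<open>graph\<close> and \<open>rel\<close> can then be read off
  blockwise.\<close>

lemma concat_append_inject:
  assumes "list_all2 (\<lambda>x u. length x = \<l> u) xs ss" and "list_all2 (\<lambda>x u. length x = \<l> u) xs' ss"
    and "concat xs @ y = concat xs' @ y'"
  shows "xs = xs' \<and> y = y'"
  using assms
proof (induction ss arbitrary: xs xs' rule: list.induct)
  case (Cons u ss)
  then obtain x zs x' zs' where "xs = x # zs" "xs' = x' # zs'" "length x = length x'"
    by (auto simp: list_all2_Cons2)
  then show ?case using Cons.prems Cons.IH[of zs zs'] by auto
qed auto

lemma ex_list_all2_pair:
  "(\<exists>xs. list_all2 P xs [s, t] \<and> Q xs) \<longleftrightarrow> (\<exists>x y. P x s \<and> P y t \<and> Q [x, y])"
  by (auto simp: list_all2_Cons2)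

locale interpretation_data =
  fixes L' :: "('t, 'g, 'q) language" and N :: "('t, 'g, 'q, 'b) struc"
    and L :: "('s, 'f, 'r) language" and M :: "('s, 'f, 'r, 'a) struc"
    and dm :: "'t \<Rightarrow> 's list" and D :: "'t \<Rightarrow> 'a list set" and h :: "'t \<Rightarrow> 'a list \<Rightarrow> 'b"
  assumes ne: "\<And>s. carrier M s \<noteq> {}"
    and str: "is_structure L' N"
    and dom: "\<And>t. definable L M (dm t) (D t)"
    and img: "\<And>t. h t ` D t = carrier N t"
    and ker: "\<And>t. definable L M (dm t @ dm t) {x @ y | x y. x \<in> D t \<and> y \<in> D t \<and> h t x = h t y}"
    and graph: "\<And>f ts t. fsig L' f = Some (ts, t) \<Longrightarrow>
       definable L M (concat (map dm ts) @ dm t)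
         {concat xs @ y | xs y. list_all2 (\<lambda>x u. x \<in> D u) xs ts \<and> y \<in> D t \<and> fint N f (map2 h ts xs) =
           h t y}"
    and rel: "\<And>r ts. rsig L' r = Some ts \<Longrightarrow>
       definable L M (concat (map dm ts))
         {concat xs | xs. list_all2 (\<lambda>x u. x \<in> D u) xs ts \<and> rint N r (map2 h ts xs)}"
begin

text \<open>Each variable v of N is replaced by variables \<open>(v, i)\<close> of M, one for each
  coordinate of a code. For i beyond the length of \<open>dm\<close> the sort is unspecified;
  \<open>tup\<close> never reads these.\<close>

definition csort :: "'t var \<times> nat \<Rightarrow> 's" where
  "csort x = dm (fst (fst x)) ! snd x"

definition cells :: "'t var \<Rightarrow> ('t var \<times> nat) list" where
  "cells v = map (Pair v) [0..<length (dm (fst v))]"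

definition tup :: "('t var \<times> nat \<Rightarrow> 'a) \<Rightarrow> 't var \<Rightarrow> 'a list" where
  "tup e v = map e (cells v)"

definition dec :: "('t var \<times> nat \<Rightarrow> 'a) \<Rightarrow> 't var \<Rightarrow> 'b" where
  "dec e v = h (fst v) (tup e v)"

text \<open>\<open>dec\<close> is meaningful only where the cells hold a tuple of \<open>D\<close>,
  so every translated formula carries this condition for its free variables.\<close>

definition good :: "('t var \<times> nat \<Rightarrow> 'a) \<Rightarrow> 't var set \<Rightarrow> bool" where
  "good e V \<longleftrightarrow> (\<forall>v\<in>V. tup e v \<in> D (fst v))"

lemma csort_cells: "map csort (cells v) = dm (fst v)"
  by (auto simp: csort_def cells_def intro!: nth_equalityI)

lemma in_cells: "x \<in> set (cells v) \<longleftrightarrow> fst x = v \<and> snd x < length (dm (fst v))"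
  by (cases x) (auto simp: cells_def)

lemma D_tuples: "x \<in> D t \<Longrightarrow> x \<in> tuples M (dm t)"
  using dom[of t] by (auto simp: definable_def)

lemma D_length: "x \<in> D t \<Longrightarrow> length x = length (dm t)"
  using D_tuples by (auto simp: tuples_def dest: list_all2_lengthD)

lemma D_carrier: "x \<in> D t \<Longrightarrow> i < length (dm t) \<Longrightarrow> x ! i \<in> carrier M (dm t ! i)"
  using D_tuples by (auto simp: tuples_def list_all2_conv_all_nth)

lemma list_all2_D_length:
  "list_all2 (\<lambda>x u. x \<in> D u) xs ss \<Longrightarrow> list_all2 (\<lambda>x u. length x = length (dm u)) xs ss"
  by (erule list_all2_mono) (rule D_length)

lemma tup_cong: "(\<And>i. i < length (dm (fst v)) \<Longrightarrow> e (v, i) = e' (v, i)) \<Longrightarrow> tup e v = tup e' v"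
  by (simp add: tup_def cells_def)

lemma dfn_good:
  assumes "finite V"
  shows "dfn L M csort (\<lambda>e. good e V)"
  unfolding good_def tup_def
  by (intro dfn_all_finite assms definable_dfn[OF dom] csort_cells ne)

lemma tm_val_dec_carrier:
  assumes "wf_tm L' t s" and "good e (tm_vars t)"
  shows "tm_val N (dec e) t \<in> carrier N s"
  using assms
proof (induction)
  case (1 s n)
  then show ?case using img[of s] by (auto simp: good_def dec_def)
next
  case (2 f ss s ts)
  have "map (tm_val N (dec e)) ts \<in> tuples N ss"
    using 2 unfolding tuples_def list_all2_conv_all_nth good_def by fastforce
  then show ?case using str 2(1) by (auto simp: is_structure_def)
qed

definition tm_graph :: "('t, 'g) tm \<Rightarrow> 't var \<Rightarrow> ('t var \<times> nat \<Rightarrow> 'a) \<Rightarrow> bool" where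
  "tm_graph t y e \<longleftrightarrow> good e (tm_vars t) \<and> tup e y \<in> D (fst y) \<and> dec e y = tm_val N (dec e) t"

text \<open>
  Nested terms are unfolded by quantifying over codes of their values, held in the cells of fresh
  variables z i of N.
\<close>

lemma dfn_args:
  assumes args: "\<And>i m. i < length ss \<Longrightarrow> dfn L M csort (tm_graph (ts ! i) (ss ! i, m))"
    and len: "length ts = length ss"
    and S: "definable L M (concat (map dm ss) @ map csort ws) S"
  shows "dfn L M csort (\<lambda>e. good e (\<Union> (set (map tm_vars ts))) \<and>
     (\<exists>xs. list_all2 (\<lambda>x u. x \<in> D u) xs ss \<and> map2 h ss xs = map (tm_val N (dec e)) ts \<and>
           concat xs @ map e ws \<in> S))"
proof -
  define V where "V = \<Union> (set (map tm_vars ts)) \<union> fst ` set ws"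
  have finV: "finite V" by (auto simp: V_def finite_tm_vars)
  \<comment> \<open>No variable in V has index k or more, so the cells of \<open>z i\<close>, whose
    index is k + i, do not interfere with the given assignment.\<close>
  define k where "k = Suc (Max (insert 0 (snd ` V)))"
  have k: "snd v < k" if "v \<in> V" for v
    using that finV by (auto simp: k_def less_Suc_eq_le intro!: Max_ge)
  define z where "z i = (ss ! i, k + i)" for i
  define zs where "zs = map z [0..<length ss]"
  define A where "A = set (concat (map cells zs))"
  have notA: "x \<notin> A" if "fst x \<in> V" for x
    using k[OF that] by (auto simp: A_def zs_def in_cells z_def)
  have zA: "(z i, j) \<in> A" if "i < length ss" "j < length (dm (ss ! i))" for i j
    using that by (auto simp: A_def zs_def in_cells z_def intro!: bexI[of _ i])
  define R where "R e \<longleftrightarrow> (\<forall>i\<in>{..<length ss}. tm_graph (ts ! i) (z i) e) \<and>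
     map e (concat (map cells zs) @ ws) \<in> S" for e
  have "map (\<lambda>x. map csort (cells x)) zs = map dm ss"
    by (intro nth_equalityI) (auto simp: csort_cells zs_def z_def)
  then have "map csort (concat (map cells zs) @ ws) = concat (map dm ss) @ map csort ws"
    by (simp add: map_concat comp_def)
  then have "dfn L M csort R"
    unfolding R_def[abs_def] z_def
    by (intro dfn_conj dfn_all_finite definable_dfn[OF S] ne args) (auto simp: z_def)
  then have *: "dfn L M csort (\<lambda>e. \<exists>f\<in>vals M csort. R (override_on e f A))"
    by (intro dfn_ex_set ne) (auto simp: A_def)
  show ?thesis
  proof (rule dfn_cong[OF *])
    fix e assume e: "e \<in> vals M csort"
    have tupV: "tup (override_on e f A) v = tup e v" if "v \<in> V" for f v
      using notA that by (intro tup_cong) simp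
    then have decV: "dec (override_on e f A) v = dec e v" if "v \<in> V" for f v
      using that by (simp add: dec_def)
    have goodV: "good (override_on e f A) (tm_vars (ts ! i)) \<longleftrightarrow> good e (tm_vars (ts ! i))"
      and valV: "tm_val N (dec (override_on e f A)) (ts ! i) = tm_val N (dec e) (ts ! i)"
      if i: "i < length ss" for f i
    proof -
      have "tm_vars (ts ! i) \<subseteq> V" using i len by (auto simp: V_def)
      then show "good (override_on e f A) (tm_vars (ts ! i)) \<longleftrightarrow> good e (tm_vars (ts ! i))"
        "tm_val N (dec (override_on e f A)) (ts ! i) = tm_val N (dec e) (ts ! i)"
        using tupV decV by (auto simp: good_def subset_iff intro!: tm_val_cong)
    qed
    have wsV: "map (override_on e f A) ws = map e ws" for f
      using notA by (auto simp: V_def)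
    have allgood: "good e (\<Union> (set (map tm_vars ts))) \<longleftrightarrow> (\<forall>i<length ss. good e (tm_vars (ts ! i)))"
      using len by (simp add: good_def all_set_conv_all_nth)
    have R: "R (override_on e f A) \<longleftrightarrow> good e (\<Union> (set (map tm_vars ts))) \<and>
        (\<forall>i<length ss. tup (override_on e f A) (z i) \<in> D (ss ! i) \<and>
            h (ss ! i) (tup (override_on e f A) (z i)) = tm_val N (dec e) (ts ! i)) \<and>
        concat (map (tup (override_on e f A)) zs) @ map e ws \<in> S" for f
    proof -
      have "concat (map (tup (override_on e f A)) zs) = map (override_on e f A) (concat (map cells zs))"
        by (simp add: tup_def[abs_def] map_concat comp_def)
      moreover have "dec e' (z i) = h (ss ! i) (tup e' (z i))" "fst (z i) = ss ! i" for e' i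
        by (simp_all add: dec_def z_def)
      ultimately show ?thesis
        unfolding R_def tm_graph_def allgood map_append wsV using goodV valV by auto
    qed
    show "(\<exists>f\<in>vals M csort. R (override_on e f A)) \<longleftrightarrow> good e (\<Union> (set (map tm_vars ts))) \<and>
        (\<exists>xs. list_all2 (\<lambda>x u. x \<in> D u) xs ss \<and> map2 h ss xs = map (tm_val N (dec e)) ts \<and>
              concat xs @ map e ws \<in> S)"
    proof
      assume "\<exists>f\<in>vals M csort. R (override_on e f A)"
      then obtain f where f: "R (override_on e f A)" by blast
      let ?xs = "map (tup (override_on e f A)) zs"
      have "list_all2 (\<lambda>x u. x \<in> D u) ?xs ss"
        using f by (auto simp: R list_all2_conv_all_nth zs_def)
      moreover have "map2 h ss ?xs = map (tm_val N (dec e)) ts"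
        using f len by (intro nth_equalityI) (auto simp: R zs_def)
      ultimately show "good e (\<Union> (set (map tm_vars ts))) \<and>
        (\<exists>xs. list_all2 (\<lambda>x u. x \<in> D u) xs ss \<and> map2 h ss xs = map (tm_val N (dec e)) ts \<and>
              concat xs @ map e ws \<in> S)"
        using f unfolding R by blast
    next
      assume "good e (\<Union> (set (map tm_vars ts))) \<and>
        (\<exists>xs. list_all2 (\<lambda>x u. x \<in> D u) xs ss \<and> map2 h ss xs = map (tm_val N (dec e)) ts \<and>
              concat xs @ map e ws \<in> S)"
      then obtain xs where g: "good e (\<Union> (set (map tm_vars ts)))"
        and xs: "list_all2 (\<lambda>x u. x \<in> D u) xs ss" "map2 h ss xs = map (tm_val N (dec e)) ts"
          "concat xs @ map e ws \<in> S" by blast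
      have lxs: "length xs = length ss" using xs(1) by (rule list_all2_lengthD)
      have xD: "xs ! i \<in> D (ss ! i)" if "i < length ss" for i
        using xs(1) that by (simp add: list_all2_conv_all_nth)
      \<comment> \<open>The code \<open>xs ! i\<close> is stored in the cells of \<open>z i\<close>:
        the index m = k + i is decoded as \<open>m - k\<close>, and all other cells keep their value
        under e.\<close>
      define f where "f x = (case x of ((s, m), j) \<Rightarrow>
         if k \<le> m \<and> m - k < length ss \<and> s = ss ! (m - k) \<and> j < length (dm s) then xs ! (m - k) ! j
         else e x)" for x
      have "f x \<in> carrier M (csort x)" for x
        using e D_carrier[OF xD] by (cases x) (auto simp: f_def csort_def vals_def split: prod.split)
      then have fv: "f \<in> vals M csort" by (simp add: vals_def)
      have t: "tup (override_on e f A) (z i) = xs ! i" if i: "i < length ss" for i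
      proof (rule nth_equalityI)
        show "length (tup (override_on e f A) (z i)) = length (xs ! i)"
          using D_length[OF xD[OF i]] by (simp add: tup_def cells_def z_def)
        fix j assume "j < length (tup (override_on e f A) (z i))"
        then have j: "j < length (dm (ss ! i))" by (simp add: tup_def cells_def z_def)
        have "f (z i, j) = xs ! i ! j" using i j by (simp add: f_def z_def)
        then show "tup (override_on e f A) (z i) ! j = xs ! i ! j"
          using j zA[OF i j] by (simp add: tup_def cells_def) (simp add: z_def)
      qed
      have "map (tup (override_on e f A)) zs = xs"
        using t lxs by (intro nth_equalityI) (auto simp: zs_def)
      moreover have "h (ss ! i) (xs ! i) = tm_val N (dec e) (ts ! i)" if "i < length ss" for i
        using arg_cong[OF xs(2), of "\<lambda>l. l ! i"] that lxs len by simp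
      ultimately have "R (override_on e f A)"
        using g xs(3) t xD by (simp add: R)
      then show "\<exists>f\<in>vals M csort. R (override_on e f A)" using fv by blast
    qed
  qed
qed

text \<open>Surjectivity of the coordinate maps provides codes for the values of the arguments.
  Hence the existential quantifier over codes in \<open>dfn_args\<close> is no restriction.\<close>

lemma ex_codes:
  assumes "list_all2 (wf_tm L') ts ss" and "good e (\<Union> (set (map tm_vars ts)))"
  shows "\<exists>xs. list_all2 (\<lambda>x u. x \<in> D u) xs ss \<and> map2 h ss xs = map (tm_val N (dec e)) ts"
  using assms
proof (induction)
  case (Cons t ts s ss)
  then have "tm_val N (dec e) t \<in> h s ` D s"
    using tm_val_dec_carrier[of t s e] by (auto simp: img good_def)
  then obtain x where "x \<in> D s" "h s x = tm_val N (dec e) t" by auto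
  moreover obtain xs where "list_all2 (\<lambda>x u. x \<in> D u) xs ss" "map2 h ss xs = map (tm_val N (dec e)) ts"
    using Cons by (auto simp: good_def)
  ultimately show ?case by (intro exI[of _ "x # xs"]) auto
qed simp

text \<open>The index m is arbitrary, so the value can be asked for in any variable of sort s, in
  particular in the fresh ones that \<open>dfn_args\<close> introduces.\<close>

lemma dfn_tm_graph:
  assumes "wf_tm L' t s"
  shows "dfn L M csort (tm_graph t (s, m))"
  using assms
proof (induction arbitrary: m)
  case (1 s n)
  have "dfn L M csort (\<lambda>e. map e (cells (s, m) @ cells (s, n)) \<in>
      {x @ y | x y. x \<in> D s \<and> y \<in> D s \<and> h s x = h s y})"
    by (rule definable_dfn[OF ker]) (simp add: csort_cells)
  then show ?case
  proof (rule dfn_cong)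
    fix e
    have "tup e (s, m) @ tup e (s, n) \<in> {x @ y | x y. x \<in> D s \<and> y \<in> D s \<and> h s x = h s y} \<longleftrightarrow>
      tup e (s, m) \<in> D s \<and> tup e (s, n) \<in> D s \<and> h s (tup e (s, m)) = h s (tup e (s, n))"
    proof -
      have "length (tup e (s, j)) = length (dm s)" for j by (simp add: tup_def cells_def)
      then show ?thesis using D_length[of _ s] by auto
    qed
    then show "map e (cells (s, m) @ cells (s, n)) \<in>
      {x @ y | x y. x \<in> D s \<and> y \<in> D s \<and> h s x = h s y} \<longleftrightarrow> tm_graph (Var (s, n)) (s, m) e"
      by (auto simp: tm_graph_def tup_def good_def dec_def)
  qed
next
  case (2 f ss s ts)
  have wf: "list_all2 (wf_tm L') ts ss" using 2(2) by (rule list_all2_mono) blast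
  have len: "length ts = length ss" using wf by (rule list_all2_lengthD)
  let ?S = "{concat xs @ y | xs y. list_all2 (\<lambda>x u. x \<in> D u) xs ss \<and> y \<in> D s \<and>
    fint N f (map2 h ss xs) = h s y}"
  have "dfn L M csort (\<lambda>e. good e (\<Union> (set (map tm_vars ts))) \<and>
     (\<exists>xs. list_all2 (\<lambda>x u. x \<in> D u) xs ss \<and> map2 h ss xs = map (tm_val N (dec e)) ts \<and>
           concat xs @ map e (cells (s, m)) \<in> ?S))"
    using graph[OF 2(1)] 2(2) len
    by (intro dfn_args) (auto simp: csort_cells list_all2_conv_all_nth)
  then show ?case
  proof (rule dfn_cong)
    fix e
    have inj: "concat xs @ tup e (s, m) \<in> ?S \<longleftrightarrow> tup e (s, m) \<in> D s \<and> fint N f (map2 h ss xs) =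
      h s (tup e (s, m))"
      if xs: "list_all2 (\<lambda>x u. x \<in> D u) xs ss" for xs
      using xs concat_append_inject[OF list_all2_D_length[OF xs] list_all2_D_length] by blast
    show "good e (\<Union> (set (map tm_vars ts))) \<and>
       (\<exists>xs. list_all2 (\<lambda>x u. x \<in> D u) xs ss \<and> map2 h ss xs = map (tm_val N (dec e)) ts \<and>
           concat xs @ map e (cells (s, m)) \<in> ?S) \<longleftrightarrow> tm_graph (App f ts) (s, m) e"
      (is "?good \<and> (\<exists>xs. ?codes xs \<and> ?vals xs \<and> _) \<longleftrightarrow> _")
    proof -
      define S where "S = ?S"
      have "(\<exists>xs. ?codes xs \<and> ?vals xs \<and> concat xs @ tup e (s, m) \<in> S) \<longleftrightarrow>
          (\<exists>xs. ?codes xs \<and> ?vals xs) \<and> tup e (s, m) \<in> D s \<and>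
          fint N f (map (tm_val N (dec e)) ts) = h s (tup e (s, m))"
        by (auto simp: inj[folded S_def])
      then show ?thesis
        using ex_codes[OF wf, of e]
        by (auto simp: tm_graph_def dec_def[of e "(s, m)"] S_def simp flip: tup_def)
    qed
  qed
qed

text \<open>The condition \<open>good\<close> stands beside the translated truth value, not inside
  it, because a negation must not turn inadmissible assignments into solutions.\<close>

lemma dfn_fm_code:
  assumes "wf_fm L' \<phi>"
  shows "dfn L M csort (\<lambda>e. good e (fm_vars \<phi>) \<and> sat N (dec e) \<phi>)"
  using assms
proof (induction \<phi>)
  case (Eq t u)
  then obtain s where s: "wf_tm L' t s" "wf_tm L' u s" by auto
  let ?S = "{x @ y | x y. x \<in> D s \<and> y \<in> D s \<and> h s x = h s y}"
  have "dfn L M csort (\<lambda>e. good e (\<Union> (set (map tm_vars [t, u]))) \<and>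
     (\<exists>xs. list_all2 (\<lambda>x u. x \<in> D u) xs [s, s] \<and> map2 h [s, s] xs = map (tm_val N (dec e)) [t, u] \<and>
           concat xs @ map e [] \<in> ?S))"
    using ker[of s] s dfn_tm_graph
    by (intro dfn_args) (auto simp: less_Suc_eq)
  then show ?case
  proof (rule dfn_cong)
    fix e
    have wf: "list_all2 (wf_tm L') [t, u] [s, s]" using s by simp
    define S where "S = ?S"
    have inj: "x @ y \<in> S \<longleftrightarrow> h s x = h s y" if "x \<in> D s" "y \<in> D s" for x y
      using that D_length[of _ s] by (auto simp: S_def append_eq_append_conv)
    have "(\<exists>xs. list_all2 (\<lambda>x u. x \<in> D u) xs [s, s] \<and> map2 h [s, s] xs = map (tm_val N (dec e)) [t, u] \<and>
           concat xs @ map e [] \<in> S) \<longleftrightarrow>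
        (\<exists>x y. x \<in> D s \<and> y \<in> D s \<and> h s x = tm_val N (dec e) t \<and> h s y = tm_val N (dec e) u \<and> x @ y \<in> S)"
      by (simp add: ex_list_all2_pair del: list_all2_Cons2)
    also have "\<dots> \<longleftrightarrow> (\<exists>x y. x \<in> D s \<and> y \<in> D s \<and> h s x = tm_val N (dec e) t \<and> h s y = tm_val N (dec e) u)
        \<and> tm_val N (dec e) t = tm_val N (dec e) u"
      by (auto simp: inj) (metis inj)
    finally show "good e (\<Union> (set (map tm_vars [t, u]))) \<and>
     (\<exists>xs. list_all2 (\<lambda>x u. x \<in> D u) xs [s, s] \<and> map2 h [s, s] xs = map (tm_val N (dec e)) [t, u] \<and>
           concat xs @ map e [] \<in> ?S) \<longleftrightarrow> good e (fm_vars (Eq t u)) \<and> sat N (dec e) (Eq t u)"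
      using ex_codes[OF wf, of e] by (auto simp: ex_list_all2_pair S_def)
  qed
next
  case (Rel r ts)
  then obtain ss where ss: "rsig L' r = Some ss" "list_all2 (wf_tm L') ts ss" by auto
  have len: "length ts = length ss" using ss(2) by (rule list_all2_lengthD)
  let ?S = "{concat xs | xs. list_all2 (\<lambda>x u. x \<in> D u) xs ss \<and> rint N r (map2 h ss xs)}"
  have "dfn L M csort (\<lambda>e. good e (\<Union> (set (map tm_vars ts))) \<and>
     (\<exists>xs. list_all2 (\<lambda>x u. x \<in> D u) xs ss \<and> map2 h ss xs = map (tm_val N (dec e)) ts \<and>
           concat xs @ map e [] \<in> ?S))"
    using rel[OF ss(1)] ss(2) len dfn_tm_graph
    by (intro dfn_args) (auto simp: list_all2_conv_all_nth)
  then show ?case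
  proof (rule dfn_cong)
    fix e
    have inj: "concat xs \<in> ?S \<longleftrightarrow> rint N r (map2 h ss xs)"
      if xs: "list_all2 (\<lambda>x u. x \<in> D u) xs ss" for xs
      using xs concat_append_inject[OF list_all2_D_length[OF xs] list_all2_D_length, of _ "[]" "[]"]
        by auto
    show "good e (\<Union> (set (map tm_vars ts))) \<and>
       (\<exists>xs. list_all2 (\<lambda>x u. x \<in> D u) xs ss \<and> map2 h ss xs = map (tm_val N (dec e)) ts \<and>
           concat xs @ map e [] \<in> ?S) \<longleftrightarrow> good e (fm_vars (Rel r ts)) \<and> sat N (dec e) (Rel r ts)"
      (is "?good \<and> (\<exists>xs. ?codes xs \<and> ?vals xs \<and> _) \<longleftrightarrow> _")
    proof -
      define S where "S = ?S"
      have "(\<exists>xs. ?codes xs \<and> ?vals xs \<and> concat xs \<in> S) \<longleftrightarrow>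
          (\<exists>xs. ?codes xs \<and> ?vals xs) \<and> rint N r (map (tm_val N (dec e)) ts)"
        by (auto simp: inj[folded S_def])
      then show ?thesis
        using ex_codes[OF ss(2), of e] by (auto simp: S_def)
    qed
  qed
next
  case (Neg \<phi>)
  then have "dfn L M csort (\<lambda>e. good e (fm_vars \<phi>) \<and> sat N (dec e) \<phi>)" by simp
  from dfn_conj[OF dfn_good[OF finite_fm_vars] dfn_neg[OF this]] show ?case
    by (rule dfn_cong) auto
next
  case (Conj \<phi> \<psi>)
  then have "dfn L M csort (\<lambda>e. (good e (fm_vars \<phi>) \<and> sat N (dec e) \<phi>) \<and> good e (fm_vars \<psi>) \<and>
    sat N (dec e) \<psi>)"
    by (intro dfn_conj[of L M csort "\<lambda>e. good e (fm_vars \<phi>) \<and> sat N (dec e) \<phi>"]) auto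
  then show ?case by (rule dfn_cong) (auto simp: good_def)
next
  case (Ex v \<phi>)
  \<comment> \<open>The extra condition on v restricts the quantifier to cells that code an element
    of N, also when v is not free in \<open>\<phi>\<close>.\<close>
  have "dfn L M csort (\<lambda>e. (good e (fm_vars \<phi>) \<and> sat N (dec e) \<phi>) \<and> good e {v})"
    using Ex by (intro dfn_conj[OF _ dfn_good]) auto
  then have "dfn L M csort (\<lambda>e. \<exists>f\<in>vals M csort.
      (good (override_on e f (set (cells v))) (fm_vars \<phi>) \<and>
        sat N (dec (override_on e f (set (cells v)))) \<phi>) \<and>
      good (override_on e f (set (cells v))) {v})"
    by (rule dfn_ex_set[rotated]) (simp_all add: ne)
  from dfn_conj[OF dfn_good this, of "fm_vars \<phi> - {v}"] show ?case
  proof (rule dfn_cong)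
    show "finite (fm_vars \<phi> - {v})" by (simp add: finite_fm_vars)
    fix e assume e: "e \<in> vals M csort"
    have tup_v: "tup (override_on e f (set (cells v))) v = tup f v" for f
      by (intro tup_cong) (simp add: in_cells override_on_def)
    have tup_other: "tup (override_on e f (set (cells v))) w = tup e w" if "w \<noteq> v" for f w
      using that by (intro tup_cong) (simp add: in_cells override_on_def)
    have dec_ov: "dec (override_on e f (set (cells v))) = (dec e)(v := h (fst v) (tup f v))" for f
      by (auto simp: fun_eq_iff dec_def tup_v tup_other)
    have good_ov: "good (override_on e f (set (cells v))) (fm_vars \<phi>) \<and>
      good (override_on e f (set (cells v))) {v} \<longleftrightarrow>
        good e (fm_vars \<phi> - {v}) \<and> tup f v \<in> D (fst v)" for f
    proof -
      have "good (override_on e f (set (cells v))) (fm_vars \<phi> - {v}) \<longleftrightarrow> good e (fm_vars \<phi> - {v})"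
        by (auto simp: good_def tup_other)
      moreover have "good (override_on e f (set (cells v))) {v} \<longleftrightarrow> tup f v \<in> D (fst v)"
        by (simp add: good_def tup_v)
      ultimately show ?thesis by (auto simp: good_def)
    qed
    \<comment> \<open>\<open>h\<close> maps \<open>D\<close> onto the carrier, so quantifying over
      codes amounts to quantifying over N.\<close>
    have "(\<exists>f\<in>vals M csort. tup f v \<in> D (fst v) \<and> sat N ((dec e)(v := h (fst v) (tup f v))) \<phi>) \<longleftrightarrow>
        (\<exists>a\<in>carrier N (fst v). sat N ((dec e)(v := a)) \<phi>)"
    proof -
      have "\<exists>f\<in>vals M csort. tup f v = x" if x: "x \<in> D (fst v)" for x
      proof -
        define f where "f y = (if y \<in> set (cells v) then x ! snd y else e y)" for y
        have "f \<in> vals M csort"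
          using e D_carrier[OF x] by (auto simp: vals_def f_def in_cells csort_def)
        moreover have "tup f v = x"
          using D_length[OF x] by (intro nth_equalityI) (auto simp: tup_def f_def in_cells, auto simp:
            cells_def)
        ultimately show ?thesis by blast
      qed
      then show ?thesis unfolding img[of "fst v", symmetric] by blast
    qed
    then show "good e (fm_vars \<phi> - {v}) \<and> (\<exists>f\<in>vals M csort.
        (good (override_on e f (set (cells v))) (fm_vars \<phi>) \<and>
          sat N (dec (override_on e f (set (cells v)))) \<phi>) \<and>
        good (override_on e f (set (cells v))) {v}) \<longleftrightarrow>
        good e (fm_vars (Ex v \<phi>)) \<and> sat N (dec e) (Ex v \<phi>)"
      using good_ov unfolding dec_ov fm_vars.simps sat.simps by blast
  qed
qed

lemma nip_interpreted:
  assumes "nip L M"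
  shows "nip L' N"
proof (rule nipI)
  fix \<phi> :: "('t, 'g, 'q) fm" and X
  assume wf: "wf_fm L' \<phi>"
  \<comment> \<open>The code chosen for a variable depends only on its sort and its value. Therefore
    \<open>lift\<close> commutes with \<open>override_on\<close>, and the two sides of a shattered
    family can be lifted separately.\<close>
  define lift where "lift e x =
    (if snd x < length (dm (fst (fst x)))
     then (SOME d. d \<in> D (fst (fst x)) \<and> h (fst (fst x)) d = e (fst x)) ! snd x
     else (SOME a. a \<in> carrier M (csort x)))" for e and x :: "'t var \<times> nat"
  have code: "(SOME d. d \<in> D (fst v) \<and> h (fst v) d = e v) \<in> D (fst v) \<and>
      h (fst v) (SOME d. d \<in> D (fst v) \<and> h (fst v) d = e v) = e v" if "e \<in> valuations N" for e v
  proof (rule someI_ex)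
    have "e v \<in> h (fst v) ` D (fst v)"
      using that unfolding img by (cases v) (simp add: valuations_def)
    then show "\<exists>d. d \<in> D (fst v) \<and> h (fst v) d = e v" by auto
  qed
  have lift_vals: "lift e \<in> vals M csort" if "e \<in> valuations N" for e
    using code[OF that] D_carrier ne by (auto simp: vals_def lift_def csort_def some_in_eq)
  have tup_lift: "tup (lift e) v = (SOME d. d \<in> D (fst v) \<and> h (fst v) d = e v)" if "e \<in> valuations N"
    for e v
    using code[OF that, of v] D_length
    by (intro nth_equalityI) (auto simp: tup_def cells_def lift_def)
  have dec_lift: "dec (lift e) = e" and good_lift: "good (lift e) V" if "e \<in> valuations N" for e V
    using code[OF that] by (auto simp: dec_def good_def tup_lift[OF that] fun_eq_iff)
  have ov: "override_on (lift e) (lift f) {x. fst x \<in> X} = lift (override_on e f X)" for e f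
    by (auto simp: override_on_def lift_def fun_eq_iff)
  have ov_val: "override_on e f X \<in> valuations N" if "e \<in> valuations N" "f \<in> valuations N" for e f
    using that by (auto simp: override_on_def valuations_def)
  obtain n where n: "\<And>J a b. finite J \<Longrightarrow> n \<le> card J \<Longrightarrow>
      \<not> shatters (vals M csort) {x. fst x \<in> X} (\<lambda>e. good e (fm_vars \<phi>) \<and> sat N (dec e) \<phi>) J a b"
    using nip_dfn_bound[OF assms dfn_fm_code[OF wf], of "{x. fst x \<in> X}"] by blast
  have "\<not> shatters (valuations N) X (\<lambda>e. sat N e \<phi>) {..<n} a b" for a b
  proof
    assume "shatters (valuations N) X (\<lambda>e. sat N e \<phi>) {..<n} a b"
    then have "shatters (vals M csort) {x. fst x \<in> X} (\<lambda>e. good e (fm_vars \<phi>) \<and> sat N (dec e) \<phi>) {..<n}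
        (\<lambda>i. lift (a i)) (\<lambda>I. lift (b I))"
      unfolding shatters_def ov by (simp add: lift_vals dec_lift good_lift ov_val)
    then show False using n[of "{..<n}"] by simp
  qed
  then show "\<exists>n. \<forall>a b. \<not> shatters (valuations N) X (\<lambda>e. sat N e \<phi>) {..<n} a b" by blast
qed

end

lemma nip_interpretable:
  assumes "interpretable_in L' N L M" and "is_structure L' N" and "\<And>s. carrier M s \<noteq> {}"
    and "nip L M"
  shows "nip L' N"
proof -
  obtain dm D h where "interpretation_data L' N L M dm D h"
    using assms(1-3) unfolding interpretable_in_def interpretation_data_def by (elim exE conjE) blast
  then show ?thesis using assms(4) by (rule interpretation_data.nip_interpreted)
qed

section \<open>Coordinates: from vector space formulas to field formulas\<close>

section \<open>Linear combinations of lists\<close>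

text \<open>Coefficients are indexed by positions in a list rather than by basis vectors, so that
  the same coefficients make sense for different frames. Coefficients beyond the list are
  ignored.\<close>

definition lincomb :: "('k::field \<Rightarrow> 'v::ab_group_add \<Rightarrow> 'v) \<Rightarrow> 'v list \<Rightarrow> (nat \<Rightarrow> 'k) \<Rightarrow> 'v" where
  "lincomb scale bs c = (\<Sum>j<length bs. scale (c j) (bs ! j))"

lemma lincomb_Nil [simp]: "lincomb scale [] c = 0"
  by (simp add: lincomb_def)

lemma lincomb_snoc: "lincomb scale (bs @ [v]) c = lincomb scale bs c + scale (c (length bs)) v"
  by (simp add: lincomb_def nth_append)

lemma lincomb_append:
  "lincomb scale (xs @ ys) c = lincomb scale xs c + lincomb scale ys (\<lambda>j. c (length xs + j))"
proof (induction ys rule: rev_induct)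
  case (snoc y ys)
  then show ?case
    using lincomb_snoc[of scale "xs @ ys" y c] by (simp add: lincomb_snoc add.assoc)
qed simp

lemma lincomb_cong:
  "(\<And>j. j < length bs \<Longrightarrow> c j = c' j) \<Longrightarrow> lincomb scale bs c = lincomb scale bs c'"
  by (simp add: lincomb_def)

context vector_space
begin

lemma lincomb_in_span: "lincomb scale bs c \<in> span (set bs)"
  unfolding lincomb_def by (intro span_sum span_scale span_base) auto

lemma span_imp_lincomb: "v \<in> span (set bs) \<Longrightarrow> \<exists>c. v = lincomb scale bs c"
proof (induction bs arbitrary: v rule: rev_induct)
  case (snoc b bs)
  then obtain k where "v - scale k b \<in> span (set bs)"
    by (auto simp: span_breakdown_eq)
  then obtain c where c: "v - scale k b = lincomb scale bs c"
    using snoc.IH by blast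
  have "lincomb scale bs (c(length bs := k)) = lincomb scale bs c"
    by (rule lincomb_cong) auto
  then have "v = lincomb scale (bs @ [b]) (c(length bs := k))"
    using c by (simp add: lincomb_snoc algebra_simps)
  then show ?case by blast
qed simp

lemma lin_indep_snoc:
  "lin_indep_tuple scale (bs @ [v]) \<longleftrightarrow> lin_indep_tuple scale bs \<and> v \<notin> span (set bs)"
  by (auto simp: lin_indep_tuple_def independent_insert dest: span_base)

lemma lincomb_diff:
  "lincomb scale bs c - lincomb scale bs c' = lincomb scale bs (\<lambda>j. c j - c' j)"
  by (simp add: lincomb_def sum_subtractf scale_left_diff_distrib)

text \<open>Indexing by position makes a repeated vector show up as a nontrivial relation, so
  distinctness is included. For fixed length this form of independence is first-order.\<close>

lemma lin_indep_iff_lincomb: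
  "lin_indep_tuple scale bs \<longleftrightarrow> (\<forall>c. lincomb scale bs c = 0 \<longrightarrow> (\<forall>j<length bs. c j = 0))"
proof (induction bs rule: rev_induct)
  case Nil
  then show ?case by (simp add: lin_indep_tuple_def independent_empty)
next
  case (snoc v bs)
  show ?case
  proof (intro iffI allI impI)
    fix c j
    assume li: "lin_indep_tuple scale (bs @ [v])" and z: "lincomb scale (bs @ [v]) c = 0"
      and j: "j < length (bs @ [v])"
    have c0: "c (length bs) = 0"
    proof (rule ccontr)
      assume nz: "c (length bs) \<noteq> 0"
      have "scale (c (length bs)) v = - lincomb scale bs c"
        using z by (simp add: lincomb_snoc eq_neg_iff_add_eq_0 add.commute)
      then have "scale (c (length bs)) v \<in> span (set bs)"
        by (simp add: span_neg lincomb_in_span)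
      then have "scale (inverse (c (length bs))) (scale (c (length bs)) v) \<in> span (set bs)"
        by (rule span_scale)
      then show False using nz li by (simp add: lin_indep_snoc)
    qed
    then have "lincomb scale bs c = 0" using z by (simp add: lincomb_snoc)
    then show "c j = 0"
      using snoc.IH li j c0 by (auto simp: lin_indep_snoc less_Suc_eq)
  next
    assume z: "\<forall>c. lincomb scale (bs @ [v]) c = 0 \<longrightarrow> (\<forall>j<length (bs @ [v]). c j = 0)"
    have ext: "lincomb scale (bs @ [v]) (c(length bs := k)) = lincomb scale bs c + scale k v" for c k
      using lincomb_cong[of bs "c(length bs := k)" c scale] by (simp add: lincomb_snoc)
    have "v \<notin> span (set bs)"
    proof
      assume "v \<in> span (set bs)"
      then obtain c where c: "v = lincomb scale bs c" using span_imp_lincomb by blast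
      have "lincomb scale (bs @ [v]) (c(length bs := - 1)) = 0"
        unfolding ext by (simp flip: c)
      then show False using z by fastforce
    qed
    moreover have "c j = 0" if "lincomb scale bs c = 0" "j < length bs" for c j
      using z[rule_format, of "c(length bs := 0)" j] ext[of c 0] that by simp
    ultimately show "lin_indep_tuple scale (bs @ [v])"
      using snoc.IH by (simp add: lin_indep_snoc)
  qed
qed

lemma lincomb_eq_iff:
  assumes "lin_indep_tuple scale bs"
  shows "lincomb scale bs c = lincomb scale bs c' \<longleftrightarrow> (\<forall>j<length bs. c j = c' j)"
proof
  assume "lincomb scale bs c = lincomb scale bs c'"
  then have "lincomb scale bs (\<lambda>j. c j - c' j) = 0"
    by (simp flip: lincomb_diff)
  then show "\<forall>j<length bs. c j = c' j"
    using assms unfolding lin_indep_iff_lincomb by fastforce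
qed (auto intro: lincomb_cong)

end

section \<open>Translating vector space formulas into field formulas\<close>

datatype kvar = VC nat nat | SC nat

primrec kenc :: "kvar \<Rightarrow> nat" where
  "kenc (VC n j) = 2 * prod_encode (n, j)"
| "kenc (SC n) = Suc (2 * n)"

text \<open>Terms of the field language take their variables from \<open>unit \<times> nat\<close>.
  The coordinate variables are therefore numbered, vector coordinates by even and scalars by odd
  numbers.\<close>

definition kdec :: "nat \<Rightarrow> kvar" where
  "kdec m = (if even m then case_prod VC (prod_decode (m div 2)) else SC (m div 2))"

lemma kdec_kenc [simp]: "kdec (kenc x) = x"
  by (cases x) (auto simp: kdec_def)

text \<open>The coordinate \<open>VC n j\<close> is the coefficient of the n-th vector variable at the j-th vector of bs.\<close>

definition frame_val ::
    "('k::field \<Rightarrow> 'v::ab_group_add \<Rightarrow> 'v) \<Rightarrow> 'v list \<Rightarrow> (kvar \<Rightarrow> 'k) \<Rightarrow> vs_sort var \<Rightarrow> 'v + 'k" where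
  "frame_val scale bs e v =
     (case fst v of Vec \<Rightarrow> Inl (lincomb scale bs (\<lambda>j. e (VC (snd v) j))) | Sca \<Rightarrow> Inr (e (SC (snd v))))"

abbreviation ktm_val :: "(kvar \<Rightarrow> 'k::field) \<Rightarrow> (unit, field_fun) tm \<Rightarrow> 'k" where
  "ktm_val e \<equiv> tm_val field_struct (\<lambda>v. e (kdec (snd v)))"

lemma field_struct_simps [simp]:
  "carrier field_struct s = UNIV" "fint field_struct = field_op"
  by (simp_all add: field_struct_def)

lemma vs_struct_simps [simp]:
  "carrier (vs_struct scale) = vs_carrier" "fint (vs_struct scale) = vs_op scale"
  by (simp_all add: vs_struct_def)

lemma vals_field_struct [simp]: "vals field_struct \<sigma> = UNIV"
  by (simp add: vals_def)

lemma dfn_ktm_eq: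
  assumes "wf_tm field_lang t ()" and "wf_tm field_lang u ()"
  shows "dfn field_lang field_struct (\<lambda>_. ()) (\<lambda>e. ktm_val e t = ktm_val e u)"
proof -
  have "wf_fm field_lang (Eq t u)" using assms by auto
  moreover have "sorted_subst field_struct fst (\<lambda>_. ()) (\<lambda>v. Inl (kdec (snd v)))"
    by (simp add: sorted_subst_def)
  ultimately show ?thesis
    unfolding dfn_def by (intro exI[of _ "Eq t u"] exI[of _ "\<lambda>v. Inl (kdec (snd v))"])
      (simp add: pull_def[abs_def])
qed

context vector_space
begin

text \<open>Addition and scalar multiplication act coordinatewise, so the j-th coordinate of a
  vector term is a field term in the j-th coordinates of the vector variables and in the scalars.
  The field terms are the same for all frames; independence of the frame enters only with
  equality.\<close>

lemma tm_coordinates: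
  assumes "wf_tm vs_lang t s"
  shows "(s = Sca \<longrightarrow> (\<exists>t'. wf_tm field_lang t' () \<and>
            (\<forall>bs e. tm_val (vs_struct scale) (frame_val scale bs e) t = Inr (ktm_val e t')))) \<and>
         (s = Vec \<longrightarrow> (\<exists>t'. (\<forall>j. wf_tm field_lang (t' j) ()) \<and>
            (\<forall>bs e. tm_val (vs_struct scale) (frame_val scale bs e) t =
               Inl (lincomb scale bs (\<lambda>j. ktm_val e (t' j))))))"
  using assms
proof (induction)
  case (1 s n)
  have wf: "wf_tm field_lang (Var ((), kenc x)) ()" for x
    by (rule wf_tm.intros)
  have "\<exists>t'. wf_tm field_lang t' () \<and> (\<forall>(bs :: 'b list) (e :: kvar \<Rightarrow> 'a). Inr (e (SC n)) =
    (Inr (ktm_val e t') :: 'b + 'a))"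
    by (intro exI[of _ "Var ((), kenc (SC n))"]) (simp add: wf del: kenc.simps)
  moreover have "\<exists>t'. (\<forall>j. wf_tm field_lang (t' j) ()) \<and>
      (\<forall>bs e. Inl (lincomb scale bs (\<lambda>j. e (VC n j))) =
        (Inl (lincomb scale bs (\<lambda>j. ktm_val e (t' j))) :: 'b + 'a))"
    by (intro exI[of _ "\<lambda>j. Var ((), kenc (VC n j))"]) (simp add: wf del: kenc.simps)
  ultimately show ?case
    unfolding tm_val.simps frame_val_def fst_conv snd_conv by (cases s) auto
next
  case (2 f ss s ts)
  then have ss: "ss = fst (vs_fsig f)" "s = snd (vs_fsig f)"
    by (simp_all add: vs_lang_def)
  show ?case
  proof (cases f)
    case VAdd
    then obtain t1 t2 where ts: "ts = [t1, t2]"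
      using 2(2) ss by (auto simp: list_all2_Cons2)
    obtain t1' where t1': "\<And>j. wf_tm field_lang (t1' j) ()"
      "\<And>bs e. tm_val (vs_struct scale) (frame_val scale bs e) t1 =
        Inl (lincomb scale bs (\<lambda>j. ktm_val e (t1' j)))"
      using 2(2) ss VAdd ts by auto
    obtain t2' where t2': "\<And>j. wf_tm field_lang (t2' j) ()"
      "\<And>bs e. tm_val (vs_struct scale) (frame_val scale bs e) t2 =
        Inl (lincomb scale bs (\<lambda>j. ktm_val e (t2' j)))"
      using 2(2) ss VAdd ts by auto
    have "wf_tm field_lang (App FAdd [t1' j, t2' j]) ()" for j
      using t1'(1) t2'(1) by (intro wf_tm.intros(2)) (auto simp: field_lang_def numeral_2_eq_2)
    moreover have "tm_val (vs_struct scale) (frame_val scale bs e) (App f ts) =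
        Inl (lincomb scale bs (\<lambda>j. ktm_val e (App FAdd [t1' j, t2' j])))" for bs e
      by (simp add: VAdd ts t1' t2' lincomb_def sum.distrib scale_left_distrib)
    ultimately show ?thesis
      unfolding ss VAdd by (auto simp del: tm_val.simps intro!: exI[of _ "\<lambda>j. App FAdd [t1' j, t2' j]"])
  next
    case VZero
    have "wf_tm field_lang (App FZero []) ()"
      by (intro wf_tm.intros(2)) (auto simp: field_lang_def)
    moreover have "tm_val (vs_struct scale) (frame_val scale bs e) (App f ts) =
        Inl (lincomb scale bs (\<lambda>j. ktm_val e (App FZero [])))" for bs e
      by (simp add: VZero lincomb_def)
    ultimately show ?thesis
      unfolding ss VZero by (auto simp del: tm_val.simps intro!: exI[of _ "\<lambda>j. App FZero []"])
  next
    case Scal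
    then obtain t1 t2 where ts: "ts = [t1, t2]"
      using 2(2) ss by (auto simp: list_all2_Cons2)
    obtain t1' where t1': "wf_tm field_lang t1' ()"
      "\<And>bs e. tm_val (vs_struct scale) (frame_val scale bs e) t1 = Inr (ktm_val e t1')"
      using 2(2) ss Scal ts by auto
    obtain t2' where t2': "\<And>j. wf_tm field_lang (t2' j) ()"
      "\<And>bs e. tm_val (vs_struct scale) (frame_val scale bs e) t2 =
        Inl (lincomb scale bs (\<lambda>j. ktm_val e (t2' j)))"
      using 2(2) ss Scal ts by auto
    have "wf_tm field_lang (App FMul [t1', t2' j]) ()" for j
      using t1'(1) t2'(1) by (intro wf_tm.intros(2)) (auto simp: field_lang_def numeral_2_eq_2)
    moreover have "tm_val (vs_struct scale) (frame_val scale bs e) (App f ts) =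
        Inl (lincomb scale bs (\<lambda>j. ktm_val e (App FMul [t1', t2' j])))" for bs e
      by (simp add: Scal ts t1' t2' lincomb_def scale_sum_right)
    ultimately show ?thesis
      unfolding ss Scal by (auto simp del: tm_val.simps intro!: exI[of _ "\<lambda>j. App FMul [t1', t2' j]"])
  next
    case (Fld g)
    have len: "length ts = field_arity g"
      using 2(2) ss Fld by (auto dest: list_all2_lengthD)
    have "\<exists>t'. wf_tm field_lang t' () \<and>
        (\<forall>bs e. tm_val (vs_struct scale) (frame_val scale bs e) t = Inr (ktm_val e t'))" if "t \<in>
          set ts" for t
      using 2(2) ss Fld that by (auto simp: list_all2_conv_all_nth in_set_conv_nth)
    then obtain T where T: "\<And>t. t \<in> set ts \<Longrightarrow> wf_tm field_lang (T t) ()"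
      "\<And>t bs e. t \<in> set ts \<Longrightarrow> tm_val (vs_struct scale) (frame_val scale bs e) t = Inr (ktm_val e (T t))"
      by metis
    have "wf_tm field_lang (App g (map T ts)) ()"
      using T(1) len by (intro wf_tm.intros(2)) (auto simp: field_lang_def list_all2_conv_all_nth)
    moreover have "tm_val (vs_struct scale) (frame_val scale bs e) (App f ts) =
      Inr (ktm_val e (App g (map T ts)))" for bs e
    proof -
      have "map (projr \<circ> tm_val (vs_struct scale) (frame_val scale bs e)) ts = map (ktm_val e \<circ> T) ts"
        using T(2) by (intro map_cong) auto
      then show ?thesis
        unfolding Fld by (simp del: map_eq_conv)
    qed
    ultimately show ?thesis
      unfolding ss Fld by (auto simp del: tm_val.simps intro!: exI[of _ "App g (map T ts)"])
  qed
qed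

end

lemma fst_snd_vs_cases: "v = (Vec, snd v) \<or> v = (Sca, snd v)"
  by (cases v; cases "fst v") auto

context vector_space
begin

lemma frame_val_upd_Sca:
  "(frame_val scale bs e)((Sca, n) := Inr a) = frame_val scale bs (e(SC n := a))"
  by (auto simp: fun_eq_iff frame_val_def split: vs_sort.splits)

lemma frame_val_upd_Vec:
  "(frame_val scale bs e)((Vec, n) := Inl (lincomb scale bs c)) =
   frame_val scale bs (override_on e (\<lambda>x. case x of VC m j \<Rightarrow> c j | SC m \<Rightarrow> 0) (VC n ` {..<length bs}))"
  by (auto simp: fun_eq_iff frame_val_def override_on_def image_iff split: vs_sort.splits intro!:
    lincomb_cong)

text \<open>By Steinitz exchange, whether any vector lies outside the span of a frame depends only
  on the length of the frame. The translation can therefore treat this as a truth value attached to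
  d.\<close>

lemma ex_longer_lin_indep_iff:
  assumes "lin_indep_tuple scale bs"
  shows "(\<exists>bs'. lin_indep_tuple scale bs' \<and> length bs' = Suc (length bs)) \<longleftrightarrow> span (set bs) \<noteq> UNIV"
proof
  assume "\<exists>bs'. lin_indep_tuple scale bs' \<and> length bs' = Suc (length bs)"
  then obtain bs' where bs': "lin_indep_tuple scale bs'" "length bs' = Suc (length bs)" by blast
  show "span (set bs) \<noteq> UNIV"
  proof
    assume "span (set bs) = UNIV"
    then have "card (set bs') \<le> card (set bs)"
      using independent_span_bound[of "set bs" "set bs'"] bs'(1) by (simp add: lin_indep_tuple_def)
    then show False
      using bs' assms by (simp add: lin_indep_tuple_def distinct_card)
  qed
next
  assume "span (set bs) \<noteq> UNIV"
  then obtain v where "v \<notin> span (set bs)" by blast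
  then show "\<exists>bs'. lin_indep_tuple scale bs' \<and> length bs' = Suc (length bs)"
    using assms by (intro exI[of _ "bs @ [v]"]) (simp add: lin_indep_snoc)
qed

text \<open>
  A vector quantifier either stays in the span of the frame bs, and becomes a block of field
  quantifiers, or it leaves the span, and then by symmetry its witness is a new vector of the frame.
\<close>

lemma ex_translation:
  assumes "wf_fm vs_lang \<phi>"
  shows "\<exists>P. \<forall>d. dfn field_lang (field_struct :: (unit, field_fun, unit, 'a) struc) (\<lambda>_. ()) (P d) \<and>
     (\<forall>bs e. lin_indep_tuple scale bs \<longrightarrow> length bs = d \<longrightarrow>
        (sat (vs_struct scale) (frame_val scale bs e) \<phi> \<longleftrightarrow> P d e))"
  using assms
proof (induction \<phi>)
  case (Eq t u)
  then obtain s where s: "wf_tm vs_lang t s" "wf_tm vs_lang u s" by auto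
  show ?case
  proof (cases s)
    case Vec
    obtain t' where t': "\<And>j. wf_tm field_lang (t' j) ()"
      "\<And>bs e. tm_val (vs_struct scale) (frame_val scale bs e) t =
        Inl (lincomb scale bs (\<lambda>j. ktm_val e (t' j)))"
      using tm_coordinates[OF s(1)] Vec by auto
    obtain u' where u': "\<And>j. wf_tm field_lang (u' j) ()"
      "\<And>bs e. tm_val (vs_struct scale) (frame_val scale bs e) u =
        Inl (lincomb scale bs (\<lambda>j. ktm_val e (u' j)))"
      using tm_coordinates[OF s(2)] Vec by auto
    show ?thesis
      by (intro exI[of _ "\<lambda>d e. \<forall>j\<in>{..<d}. ktm_val e (t' j) = ktm_val e (u' j)"] allI conjI
          dfn_all_finite dfn_ktm_eq t' u')
        (auto simp: t' u' lincomb_eq_iff)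
  next
    case Sca
    obtain t' where t': "wf_tm field_lang t' ()"
      "\<And>bs e. tm_val (vs_struct scale) (frame_val scale bs e) t = Inr (ktm_val e t')"
      using tm_coordinates[OF s(1)] Sca by auto
    obtain u' where u': "wf_tm field_lang u' ()"
      "\<And>bs e. tm_val (vs_struct scale) (frame_val scale bs e) u = Inr (ktm_val e u')"
      using tm_coordinates[OF s(2)] Sca by auto
    show ?thesis
      by (intro exI[of _ "\<lambda>d e. ktm_val e t' = ktm_val e u'"] allI conjI dfn_ktm_eq t' u')
        (auto simp: t' u')
  qed
next
  case (Rel r ts)
  then show ?case by (simp add: vs_lang_def)
next
  case (Neg \<phi>)
  then obtain P where "\<forall>d. dfn field_lang (field_struct :: (unit, field_fun, unit, 'a) struc) (\<lambda>_. ())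
    (P d) \<and>
     (\<forall>bs e. lin_indep_tuple scale bs \<longrightarrow> length bs = d \<longrightarrow>
        (sat (vs_struct scale) (frame_val scale bs e) \<phi> \<longleftrightarrow> P d e))" by auto
  then show ?case
    by (intro exI[of _ "\<lambda>d e. \<not> P d e"]) (auto intro: dfn_neg)
next
  case (Conj \<phi> \<psi>)
  then obtain P where "\<forall>d. dfn field_lang (field_struct :: (unit, field_fun, unit, 'a) struc) (\<lambda>_. ())
    (P d) \<and>
     (\<forall>bs e. lin_indep_tuple scale bs \<longrightarrow> length bs = d \<longrightarrow>
        (sat (vs_struct scale) (frame_val scale bs e) \<phi> \<longleftrightarrow> P d e))" by auto
  moreover from Conj obtain Q where "\<forall>d. dfn field_lang (field_struct :: (unit, field_fun, unit, 'a)
    struc) (\<lambda>_. ()) (Q d) \<and>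
     (\<forall>bs e. lin_indep_tuple scale bs \<longrightarrow> length bs = d \<longrightarrow>
        (sat (vs_struct scale) (frame_val scale bs e) \<psi> \<longleftrightarrow> Q d e))" by auto
  ultimately show ?case
    by (intro exI[of _ "\<lambda>d e. P d e \<and> Q d e"]) (auto intro: dfn_conj)
next
  case (Ex v \<phi>)
  then obtain P where P: "\<And>d. dfn field_lang (field_struct :: (unit, field_fun, unit, 'a) struc)
    (\<lambda>_. ()) (P d)"
    "\<And>bs e. lin_indep_tuple scale bs \<Longrightarrow>
       sat (vs_struct scale) (frame_val scale bs e) \<phi> \<longleftrightarrow> P (length bs) e" by auto
  have ne: "carrier (field_struct :: (unit, field_fun, unit, 'a) struc) s \<noteq> {}" for s
    by (simp add:)
  obtain n where "v = (Sca, n) \<or> v = (Vec, n)" using fst_snd_vs_cases by blast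
  then show ?case
  proof
    assume v: "v = (Sca, n)"
    have "sat (vs_struct scale) (frame_val scale bs e) (Ex v \<phi>) \<longleftrightarrow>
        (\<exists>a \<in> carrier field_struct (). P (length bs) (e(SC n := a)))" if "lin_indep_tuple scale bs"
          for bs e
      using P(2)[OF that]
      by (auto simp: v frame_val_upd_Sca)
    then show ?thesis
      using dfn_ex[OF P(1) ne, of _ "SC n"]
      by (intro exI[of _ "\<lambda>d e. \<exists>a \<in> carrier field_struct (). P d (e(SC n := a))"]) simp
  next
    assume v: "v = (Vec, n)"
    define longer where "longer d \<longleftrightarrow> (\<exists>bs. lin_indep_tuple scale bs \<and> length bs = Suc d)" for d
    \<comment> \<open>Coordinates after a witness has been added at position d: the quantified
      variable becomes the unit vector at d, and the other vectors, which lie in the old span, get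
      coordinate 0 there.\<close>
    define r :: "nat \<Rightarrow> kvar \<Rightarrow> kvar + 'a" where
      "r d x = (case x of VC m j \<Rightarrow> if m = n then Inr (if j = d then 1 else 0)
                                    else if j = d then Inr 0 else Inl (VC m j)
                | SC m \<Rightarrow> Inl (SC m))" for d x
    define Q where "Q d e \<longleftrightarrow>
       (\<exists>f \<in> vals (field_struct :: (unit, field_fun, unit, 'a) struc) (\<lambda>_. ()).
          P d (override_on e f (VC n ` {..<d}))) \<or> longer d \<and> P (Suc d) (pull e (r d))" for d e
    have "dfn field_lang (field_struct :: (unit, field_fun, unit, 'a) struc) (\<lambda>_. ())
        (\<lambda>e. longer d \<and> P (Suc d) (pull e (r d)))" for d
    proof -
      have "dfn field_lang (field_struct :: (unit, field_fun, unit, 'a) struc) (\<lambda>_. ())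
        (\<lambda>e. P (Suc d) (pull e (r d)))"
        by (rule dfn_subst[OF P(1)]) (auto simp: sorted_subst_def split: sum.split)
      moreover have "dfn field_lang (field_struct :: (unit, field_fun, unit, 'a) struc)
        (\<lambda>_ :: kvar. ()) (\<lambda>e. False)"
        using dfn_neg[OF dfn_True[OF ne]] by simp
      \<comment> \<open>\<open>longer d\<close> does not depend on the assignment, so the condition
        is either the substituted one or a contradiction.\<close>
      ultimately show ?thesis by (cases "longer d") simp_all
    qed
    then have "dfn field_lang (field_struct :: (unit, field_fun, unit, 'a) struc) (\<lambda>_. ()) (Q d)" for d
      unfolding Q_def[abs_def]
      by (intro dfn_disj dfn_ex_set P(1) ne) auto
    moreover have "sat (vs_struct scale) (frame_val scale bs e) (Ex v \<phi>) \<longleftrightarrow> Q (length bs) e"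
      if bs: "lin_indep_tuple scale bs" for bs e
    proof -
      have inspan: "sat (vs_struct scale)
        ((frame_val scale bs e)((Vec, n) := Inl (lincomb scale bs c))) \<phi> \<longleftrightarrow>
          P (length bs) (override_on e (\<lambda>x. case x of VC m j \<Rightarrow> c j | SC m \<Rightarrow> 0)
            (VC n ` {..<length bs}))" for c
        unfolding frame_val_upd_Vec by (rule P(2)[OF bs])
      have 1: "(\<exists>u\<in>span (set bs). sat (vs_struct scale) ((frame_val scale bs e)((Vec, n) := Inl u)) \<phi>) \<longleftrightarrow>
          (\<exists>f. P (length bs) (override_on e f (VC n ` {..<length bs})))"
      proof
        assume "\<exists>u\<in>span (set bs). sat (vs_struct scale) ((frame_val scale bs e)((Vec, n) := Inl u)) \<phi>"
        then show "\<exists>f. P (length bs) (override_on e f (VC n ` {..<length bs}))"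
          using inspan span_imp_lincomb by metis
      next
        assume "\<exists>f. P (length bs) (override_on e f (VC n ` {..<length bs}))"
        then obtain f where f: "P (length bs) (override_on e f (VC n ` {..<length bs}))" by blast
        have "override_on e f (VC n ` {..<length bs}) =
          override_on e (\<lambda>x. case x of VC m j \<Rightarrow> f (VC n j) | SC m \<Rightarrow> 0) (VC n ` {..<length bs})"
          by (auto simp: override_on_def fun_eq_iff)
        then have "sat (vs_struct scale)
          ((frame_val scale bs e)((Vec, n) := Inl (lincomb scale bs (\<lambda>j. f (VC n j))))) \<phi>"
          using f by (simp add: inspan)
        then show "\<exists>u\<in>span (set bs). sat (vs_struct scale) ((frame_val scale bs e)((Vec, n) := Inl u))
          \<phi>"
          using lincomb_in_span by blast
      qed
      \<comment> \<open>The right-hand side does not mention u: either all vectors outside the span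
        of the frame are witnesses or none is.\<close>
      have 2: "sat (vs_struct scale) ((frame_val scale bs e)((Vec, n) := Inl u)) \<phi> \<longleftrightarrow>
          P (Suc (length bs)) (pull e (r (length bs)))" if u: "u \<notin> span (set bs)" for u
      proof -
        have *: "lincomb scale bs (\<lambda>j. pull e (r (length bs)) (VC m j)) =
            (if m = n then 0 else lincomb scale bs (\<lambda>j. e (VC m j)))" for m
          by (auto simp: lincomb_def pull_def r_def)
        have "(frame_val scale bs e)((Vec, n) := Inl u) = frame_val scale (bs @ [u])
          (pull e (r (length bs)))"
          by (auto simp: fun_eq_iff frame_val_def lincomb_snoc * split: vs_sort.splits)
            (auto simp: pull_def r_def)
        then show ?thesis
          using P(2)[of "bs @ [u]" "pull e (r (length bs))"] bs u by (simp add: lin_indep_snoc)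
      qed
      have "sat (vs_struct scale) (frame_val scale bs e) (Ex v \<phi>) \<longleftrightarrow>
          (\<exists>u. sat (vs_struct scale) ((frame_val scale bs e)((Vec, n) := Inl u)) \<phi>)"
        by (auto simp: v )
      also have "\<dots> \<longleftrightarrow>
        (\<exists>u\<in>span (set bs). sat (vs_struct scale) ((frame_val scale bs e)((Vec, n) := Inl u)) \<phi>)
          \<or> (span (set bs) \<noteq> UNIV \<and> P (Suc (length bs)) (pull e (r (length bs))))"
        using 2 by blast
      finally show ?thesis
        unfolding 1 Q_def longer_def ex_longer_lin_indep_iff[OF bs] by simp
    qed
    ultimately show ?thesis by (intro exI[of _ Q]) auto
  qed
qed

end

section \<open>Exact shattering from shattering with errors, and dimension counting\<close>

section \<open>Shattering up to bounded error\<close>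

lemma disjoint_parts:
  assumes "finite C" and "finite J" and "card C * M \<le> card J"
  shows "\<exists>Q. (\<forall>c\<in>C. Q c \<subseteq> J \<and> card (Q c) = M) \<and> (\<forall>c\<in>C. \<forall>c'\<in>C. c \<noteq> c' \<longrightarrow> Q c \<inter> Q c' = {})"
  using assms
proof (induction C arbitrary: J)
  case (insert x C)
  then have "M + card C * M \<le> card J" by simp
  then obtain A where A: "A \<subseteq> J" "card A = M"
    using obtain_subset_with_card_n[of M J] by auto
  have "card (J - A) = card J - M"
    using A insert.prems(1) by (simp add: card_Diff_subset finite_subset)
  then have "card C * M \<le> card (J - A)" using \<open>M + card C * M \<le> card J\<close> by simp
  from insert.IH[OF _ this] insert.prems(1) obtain Q where
    Q: "(\<forall>c\<in>C. Q c \<subseteq> J - A \<and> card (Q c) = M) \<and> (\<forall>c\<in>C. \<forall>c'\<in>C. c \<noteq> c' \<longrightarrow> Q c \<inter> Q c' = {})"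
    by auto
  show ?case
  proof (intro exI[of _ "Q(x := A)"] conjI ballI impI)
    fix c c' assume c: "c \<in> insert x C" "c' \<in> insert x C" "c \<noteq> c'"
    have "Q d \<inter> A = {}" if "d \<in> C" for d using Q that by blast
    moreover have "A \<inter> Q d = {}" if "d \<in> C" for d using Q that by blast
    moreover have "Q c \<inter> Q c' = {}" if "c \<in> C" "c' \<in> C" using Q c(3) that by blast
    ultimately show "(Q(x := A)) c \<inter> (Q(x := A)) c' = {}"
      using c by (cases "c = x"; cases "c' = x") simp_all
  qed (use A Q in auto)
qed simp

text \<open>
  If the family of all T I shattered no piece of the right colour among (q + 1) * (q + 1) disjoint
  pieces of J, one could choose I so that T I is wrong on q + 1 pieces.
\<close>

lemma approximate_shattering:
  fixes T :: "nat set \<Rightarrow> nat set" and s :: "nat set \<Rightarrow> nat"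
  assumes J: "finite J" "(q + 1) * (q + 1) * M \<le> card J"
    and s: "\<And>I. I \<subseteq> J \<Longrightarrow> s I \<le> q"
    and err: "\<And>I. I \<subseteq> J \<Longrightarrow> card {i\<in>J. (i \<in> T I) \<noteq> (i \<in> I)} \<le> q"
  shows "\<exists>c\<le>q. \<exists>J'\<subseteq>J. card J' = M \<and> (\<forall>I'\<subseteq>J'. \<exists>I\<subseteq>J. s I = c \<and> T I \<inter> J' = I')"
proof (rule ccontr)
  assume no: "\<not> ?thesis"
  \<comment> \<open>The first component is a possible value of s. The second numbers the q + 1
    pieces reserved for that value, one more than the number of errors allowed.\<close>
  let ?C = "{..q} \<times> {..q}"
  have "finite ?C" "card ?C * M \<le> card J" using J by (auto simp: card_cartesian_product)
  from disjoint_parts[OF this(1) J(1) this(2)] obtain Q where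
    "(\<forall>c\<in>?C. Q c \<subseteq> J \<and> card (Q c) = M) \<and> (\<forall>c\<in>?C. \<forall>c'\<in>?C. c \<noteq> c' \<longrightarrow> Q c \<inter> Q c' = {})" ..
  then have Q: "\<And>c. c \<in> ?C \<Longrightarrow> Q c \<subseteq> J" "\<And>c. c \<in> ?C \<Longrightarrow> card (Q c) = M"
    "\<And>c c'. c \<in> ?C \<Longrightarrow> c' \<in> ?C \<Longrightarrow> c \<noteq> c' \<Longrightarrow> Q c \<inter> Q c' = {}"
    by metis+
  have "\<exists>I'\<subseteq>Q (c, k). \<forall>I\<subseteq>J. s I = c \<longrightarrow> T I \<inter> Q (c, k) \<noteq> I'" if "c \<le> q" "k \<le> q" for c k
  proof -
    have "Q (c, k) \<subseteq> J" "card (Q (c, k)) = M" using Q that by auto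
    then show ?thesis using no that by metis
  qed
  then obtain B where B: "\<And>c k. c \<le> q \<Longrightarrow> k \<le> q \<Longrightarrow> B c k \<subseteq> Q (c, k)"
    "\<And>c k I. c \<le> q \<Longrightarrow> k \<le> q \<Longrightarrow> I \<subseteq> J \<Longrightarrow> s I = c \<Longrightarrow> T I \<inter> Q (c, k) \<noteq> B c k"
    by metis
  define I where "I = (\<Union>(c, k)\<in>?C. B c k)"
  have IJ: "I \<subseteq> J"
  proof
    fix i assume "i \<in> I"
    then obtain c k where "c \<le> q" "k \<le> q" "i \<in> B c k" by (auto simp: I_def)
    then show "i \<in> J" using B(1)[of c k] Q(1)[of "(c, k)"] by auto
  qed
  have IQ: "I \<inter> Q (c, k) = B c k" if ck: "c \<le> q" "k \<le> q" for c k
  proof -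
    have "i \<in> B c k" if "i \<in> B c' k'" "i \<in> Q (c, k)" "c' \<le> q" "k' \<le> q" for i c' k'
    proof -
      have "Q (c', k') \<inter> Q (c, k) \<noteq> {}" using B(1)[OF that(3,4)] that by blast
      then have "(c', k') = (c, k)" using Q(3)[of "(c', k')" "(c, k)"] ck that by auto
      then show ?thesis using that by simp
    qed
    then show ?thesis using B(1)[OF ck] ck by (fastforce simp: I_def)
  qed
  define c where "c = s I"
  have c: "c \<le> q" using s[OF IJ] by (simp add: c_def)
  define U where "U = {i\<in>J. (i \<in> T I) \<noteq> (i \<in> I)}"
  have "\<exists>i. i \<in> Q (c, k) \<and> i \<in> U" if k: "k \<le> q" for k
  proof -
    have "T I \<inter> Q (c, k) \<noteq> I \<inter> Q (c, k)"
      using B(2)[OF c k IJ] by (simp add: c_def IQ[OF c[unfolded c_def] k])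
    moreover have "Q (c, k) \<subseteq> J" using Q(1) c k by auto
    ultimately show ?thesis by (auto simp: U_def)
  qed
  then obtain w where w: "\<And>k. k \<le> q \<Longrightarrow> w k \<in> Q (c, k) \<and> w k \<in> U" by metis
  have "inj_on w {..q}"
  proof (rule inj_onI)
    fix k k' assume k: "k \<in> {..q}" "k' \<in> {..q}" "w k = w k'"
    then have "Q (c, k) \<inter> Q (c, k') \<noteq> {}" using w[of k] w[of k'] by auto
    then show "k = k'" using Q(3)[of "(c, k)" "(c, k')"] k c by auto
  qed
  then have "card {..q} \<le> card U"
    using w J(1) by (intro card_inj_on_le[of w]) (auto simp: U_def)
  then show False using err[OF IJ] by (simp add: U_def)
qed

section \<open>Vectors in independent position\<close>

text \<open>\<open>dependent\<close> speaks of sets and would not notice overlaps, hence the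
  disjointness conditions. Together they say that the spans of E and of the sets F i, for i in J,
  form a direct sum with these sets as bases.\<close>

definition independent_over ::
    "('k::field \<Rightarrow> 'v::ab_group_add \<Rightarrow> 'v) \<Rightarrow> 'v set \<Rightarrow> (nat \<Rightarrow> 'v set) \<Rightarrow> nat set \<Rightarrow> bool" where
  "independent_over scale E F J \<longleftrightarrow>
     (\<forall>i\<in>J. E \<inter> F i = {}) \<and> (\<forall>i\<in>J. \<forall>j\<in>J. i \<noteq> j \<longrightarrow> F i \<inter> F j = {}) \<and>
     \<not> module.dependent scale (E \<union> \<Union> (F ` J))"

context vector_space
begin

text \<open>A basis of the span of \<open>A \<union> F\<close> that extends A can be chosen inside
  \<open>A \<union> F\<close>; its part outside A is F'. If that were all of F, then F would be
  disjoint from A and independent over it.\<close>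

lemma reduce_relative_to:
  assumes "finite F" and "independent A" and "\<not> (A \<inter> F = {} \<and> independent (A \<union> F))"
  shows "\<exists>F'\<subseteq>F. card F' < card F \<and> F \<subseteq> span (A \<union> F')"
proof -
  obtain B where B: "A \<subseteq> B" "B \<subseteq> A \<union> F" "independent B" "A \<union> F \<subseteq> span B"
    using maximal_independent_subset_extend[of A "A \<union> F"] assms(2) by blast
  have "B - A \<noteq> F"
  proof
    assume "B - A = F"
    then have "A \<inter> F = {}" "A \<union> F = B" using B(1) by auto
    then show False using assms(3) B(3) by simp
  qed
  then have "B - A \<subset> F" using B(2) by blast
  moreover have "A \<union> (B - A) = B" using B(1) by blast
  ultimately show ?thesis
    using B(4) assms(1) psubset_card_mono by (intro exI[of _ "B - A"]) auto
qed

lemma extend_relative_to: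
  assumes "independent E"
  shows "\<exists>G\<subseteq>U. E \<inter> G = {} \<and> independent (E \<union> G) \<and> U \<subseteq> span (E \<union> G)"
proof -
  obtain B where B: "E \<subseteq> B" "B \<subseteq> E \<union> U" "independent B" "E \<union> U \<subseteq> span B"
    using maximal_independent_subset_extend[of E "E \<union> U"] assms by blast
  moreover have "E \<union> (B - E) = B" using B(1) by blast
  ultimately show ?thesis by (intro exI[of _ "B - E"]) auto
qed

lemma independent_over_subset: "independent_over scale E F J \<Longrightarrow> J' \<subseteq> J \<Longrightarrow> independent_over scale E F J'"
  unfolding independent_over_def
  by (meson UN_mono Un_mono independent_mono order_refl subset_iff)

lemma few_exceptional_indices:
  assumes J: "finite J" "independent_over scale E F J" and fin: "finite E" "finite G" "\<And>i. i \<in> J \<Longrightarrow>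
    finite (F i)"
    and G: "independent (E \<union> G)"
  shows "card {i\<in>J. \<not> ((E \<union> G) \<inter> F i = {} \<and> independent ((E \<union> G) \<union> F i))} \<le> card G"
proof -
  define X where "X = {i\<in>J. \<not> ((E \<union> G) \<inter> F i = {} \<and> independent ((E \<union> G) \<union> F i))}"
  have XJ: "X \<subseteq> J" and finX: "finite X" using J(1) by (auto simp: X_def)
  have "\<exists>F'\<subseteq>F i. card F' < card (F i) \<and> F i \<subseteq> span ((E \<union> G) \<union> F')" if "i \<in> X" for i
    using that fin(3) G by (intro reduce_relative_to) (auto simp: X_def)
  then obtain F' where F': "\<And>i. i \<in> X \<Longrightarrow> F' i \<subseteq> F i" "\<And>i. i \<in> X \<Longrightarrow> card (F' i) < card (F i)"
    "\<And>i. i \<in> X \<Longrightarrow> F i \<subseteq> span ((E \<union> G) \<union> F' i)" by metis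
  have finF: "finite (F i)" if "i \<in> X" for i
    using that XJ fin(3) by blast
  have finF': "finite (F' i)" if "i \<in> X" for i
    using finite_subset[OF F'(1)[OF that] finF[OF that]] .
  have ind: "independent_over scale E F X" using J(2) XJ by (rule independent_over_subset)
  let ?S = "E \<union> \<Union> (F ` X)" and ?T = "(E \<union> G) \<union> \<Union> (F' ` X)"
  have "F i \<subseteq> span ?T" if "i \<in> X" for i
    using F'(3)[OF that] span_mono[of "(E \<union> G) \<union> F' i" ?T] that by blast
  moreover have "E \<subseteq> span ?T" by (auto intro: span_base)
  ultimately have "?S \<subseteq> span ?T" by blast
  moreover have "finite ?T" using fin finF' finX by auto
  ultimately have "card ?S \<le> card ?T"
    using independent_span_bound[of ?T ?S] ind by (simp add: independent_over_def)
  moreover have "card ?S = card E + (\<Sum>i\<in>X. card (F i))"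
  proof -
    have "E \<inter> \<Union> (F ` X) = {}" using ind by (auto simp: independent_over_def)
    then have "card ?S = card E + card (\<Union> (F ` X))"
      using fin(1) finX finF by (intro card_Un_disjoint) auto
    also have "card (\<Union> (F ` X)) = (\<Sum>i\<in>X. card (F i))"
      using ind finX finF by (intro card_UN_disjoint) (auto simp: independent_over_def)
    finally show ?thesis .
  qed
  moreover have "card ?T \<le> card E + card G + (\<Sum>i\<in>X. card (F' i))"
    using card_Un_le[of "E \<union> G" "\<Union> (F' ` X)"] card_Un_le[of E G] card_UN_le[OF finX, of F'] by linarith
  moreover have "(\<Sum>i\<in>X. card (F' i)) + card X \<le> (\<Sum>i\<in>X. card (F i))"
  proof -
    have "(\<Sum>i\<in>X. card (F' i)) + card X = (\<Sum>i\<in>X. card (F' i) + 1)"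
      by (simp only: sum.distrib card_eq_sum)
    also have "\<dots> \<le> (\<Sum>i\<in>X. card (F i))"
      using F'(2) by (intro sum_mono) (simp add: Suc_leI)
    finally show ?thesis .
  qed
  ultimately show ?thesis unfolding X_def[symmetric] by linarith
qed

end

section \<open>Vector spaces over NIP fields\<close>

text \<open>Vectors spanned by one part of a concatenated frame keep their coefficients and get
  zeros on the other part. This and \<open>lincomb_pad_left\<close> express a i and b I in one
  frame.\<close>

lemma lincomb_pad_right:
  "lincomb scale (xs @ ys) (\<lambda>j. if j < length xs then c j else 0) = lincomb scale xs c"
  if "vector_space scale"
proof -
  interpret vector_space scale by (rule that)
  show ?thesis
    using lincomb_cong[of xs "\<lambda>j. if j < length xs then c j else 0" c scale]
    by (simp add: lincomb_append) (simp add: lincomb_def)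
qed

lemma lincomb_pad_left:
  "lincomb scale (xs @ ys) (\<lambda>j. if j < length xs then 0 else c (j - length xs)) = lincomb scale ys c"
  if "vector_space scale"
proof -
  interpret vector_space scale by (rule that)
  show ?thesis
    using lincomb_cong[of xs "\<lambda>j. if j < length xs then 0 else c (j - length xs)" "\<lambda>_. 0" scale]
    by (simp add: lincomb_append) (simp add: lincomb_def)
qed

lemma vs_valuationsD:
  assumes "e \<in> valuations (vs_struct scale)"
  shows "e (Vec, n) = Inl (projl (e (Vec, n)))" and "e (Sca, n) = Inr (projr (e (Sca, n)))"
proof -
  have "e (Vec, n) \<in> range Inl" "e (Sca, n) \<in> range Inr"
    using assms by (simp_all add: valuations_def) (metis vs_carrier.simps)+
  then show "e (Vec, n) = Inl (projl (e (Vec, n)))" "e (Sca, n) = Inr (projr (e (Sca, n)))"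
    by auto
qed

lemma finite_index_set: "finite {n. (s, n) \<in> fm_vars \<phi> \<and> Q n}"
  by (rule finite_subset[of _ "snd ` fm_vars \<phi>"]) (force simp: finite_fm_vars)+

context vector_space
begin

text \<open>The cardinalities D and r are fixed exactly, so that the frame of a pair (i, I) has
  length r + D + s with s depending on I alone. Since s is at most q, finitely many field formulas
  are involved, and M majorizes their bounds.\<close>

lemma independent_family_bounded:
  fixes \<phi> :: "(vs_sort, vs_fun, unit) fm"
  assumes nip: "nip field_lang (field_struct :: (unit, field_fun, unit, 'a) struc)"
    and wf: "wf_fm vs_lang \<phi>"
  shows "\<exists>m. \<forall>J a b E F. finite J \<longrightarrow> m \<le> card J \<longrightarrow> finite E \<longrightarrow> card E = D \<longrightarrow>
     (\<forall>i\<in>J. finite (F i) \<and> card (F i) = r) \<longrightarrow>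
     (\<forall>i\<in>J. \<forall>n. (Vec, n) \<in> fm_vars \<phi> \<and> (Vec, n) \<in> X \<longrightarrow> projl (a i (Vec, n)) \<in> span (E \<union> F i)) \<longrightarrow>
     independent_over scale E F J \<longrightarrow>
     \<not> shatters (valuations (vs_struct scale)) X (\<lambda>e. sat (vs_struct scale) e \<phi>) J a b"
proof -
  obtain P where P: "\<And>d. dfn field_lang (field_struct :: (unit, field_fun, unit, 'a) struc) (\<lambda>_. ())
    (P d)"
    "\<And>bs e. lin_indep_tuple scale bs \<Longrightarrow>
       sat (vs_struct scale) (frame_val scale bs e) \<phi> \<longleftrightarrow> P (length bs) e"
    using ex_translation[OF wf] by auto
  define VY where "VY = {n. (Vec, n) \<in> fm_vars \<phi> \<and> (Vec, n) \<notin> X}"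
  define q where "q = card VY"
  define XK where "XK = {x. case x of VC n j \<Rightarrow> (Vec, n) \<in> X | SC n \<Rightarrow> (Sca, n) \<in> X}"
  have finVY: "finite VY" unfolding VY_def by (rule finite_index_set)
  have "\<exists>N. \<forall>J a b. finite J \<longrightarrow> N \<le> card J \<longrightarrow> \<not> shatters UNIV XK (P (r + D + s)) J a b" for s
    using nip_dfn_bound[OF nip P(1), of XK] by simp
  then obtain N where N: "\<And>s J a b. finite J \<Longrightarrow> N s \<le> card J \<Longrightarrow> \<not> shatters UNIV XK (P (r + D + s)) J a b"
    by metis
  define M where "M = Max (N ` {..q})"
  have NM: "N s \<le> M" if "s \<le> q" for s unfolding M_def using that by (intro Max_ge) auto
  show ?thesis
  \<comment> \<open>With this many indices \<open>approximate_shattering\<close> leaves M of them,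
    enough to contradict the bound \<open>N s\<close> for every s up to q.\<close>
  proof (intro exI[of _ "(q + 1) * (q + 1) * M"] allI impI notI)
    fix J :: "nat set" and a b and E :: "'b set" and F :: "nat \<Rightarrow> 'b set"
    assume J: "finite J" "(q + 1) * (q + 1) * M \<le> card J" and E: "finite E" "card E = D"
      and F: "\<forall>i\<in>J. finite (F i) \<and> card (F i) = r"
      and sp: "\<forall>i\<in>J. \<forall>n. (Vec, n) \<in> fm_vars \<phi> \<and> (Vec, n) \<in> X \<longrightarrow> projl (a i (Vec, n)) \<in> span (E \<union> F i)"
      and ind: "independent_over scale E F J"
      and sh: "shatters (valuations (vs_struct scale)) X (\<lambda>e. sat (vs_struct scale) e \<phi>) J a b"
    have indE: "independent E"
      using ind independent_mono[of "E \<union> \<Union> (F ` J)" E] by (simp add: independent_over_def)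
    \<comment> \<open>The vectors of b I, at most q of them. \<open>G I\<close> completes E to a
      basis for them and is chosen without regard to i.\<close>
    define Y where "Y I = (\<lambda>n. projl (b I (Vec, n))) ` VY" for I
    have "\<forall>I. \<exists>G. G \<subseteq> Y I \<and> E \<inter> G = {} \<and> independent (E \<union> G) \<and> Y I \<subseteq> span (E \<union> G)"
      using extend_relative_to[OF indE] by blast
    then obtain G where G: "\<And>I. G I \<subseteq> Y I" "\<And>I. E \<inter> G I = {}" "\<And>I. independent (E \<union> G I)"
      "\<And>I. Y I \<subseteq> span (E \<union> G I)"
      by metis
    have finY: "finite (Y I)" and cardY: "card (Y I) \<le> q" for I
      using finVY by (auto simp: Y_def q_def intro: card_image_le)
    have finG: "finite (G I)" and cardG: "card (G I) \<le> q" for I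
      using finite_subset[OF G(1) finY] card_mono[OF finY G(1)] cardY le_trans by blast+
    obtain es where es: "set es = E" "distinct es" using finite_distinct_list[OF E(1)] by blast
    have "\<forall>i\<in>J. \<exists>xs. set xs = F i \<and> distinct xs" using F finite_distinct_list by blast
    then obtain fs where fs: "\<And>i. i \<in> J \<Longrightarrow> set (fs i) = F i" "\<And>i. i \<in> J \<Longrightarrow> distinct (fs i)" by metis
    have "\<forall>I. \<exists>xs. set xs = G I \<and> distinct xs" using finG finite_distinct_list by blast
    then obtain gs where gs: "\<And>I. set (gs I) = G I" "\<And>I. distinct (gs I)" by metis
    have len: "length es = D" "\<And>i. i \<in> J \<Longrightarrow> length (fs i) = r" "\<And>I. length (gs I) = card (G I)"
      using es fs gs E(2) F distinct_card by metis+
    define good where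
      "good i I \<longleftrightarrow> (E \<union> G I) \<inter> F i = {} \<and> independent ((E \<union> G I) \<union> F i)" for i I
    have few: "card {i\<in>J. \<not> good i I} \<le> q" for I
      using few_exceptional_indices[OF J(1) ind E(1) finG[of I] _ G(3)] F cardG[of I]
      unfolding good_def by (meson le_trans)
    have lin: "lin_indep_tuple scale (fs i @ es @ gs I)" if "good i I" "i \<in> J" for i I
    proof -
      have "set (fs i @ es @ gs I) = (E \<union> G I) \<union> F i" using es fs gs that by auto
      moreover have "distinct (fs i @ es @ gs I)"
        using es fs gs that G(2) by (auto simp: good_def)
      ultimately show ?thesis using that by (simp add: lin_indep_tuple_def good_def)
    qed
    have "\<exists>c. i \<in> J \<longrightarrow> (Vec, n) \<in> fm_vars \<phi> \<longrightarrow> (Vec, n) \<in> X \<longrightarrow>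
        projl (a i (Vec, n)) = lincomb scale (fs i @ es) c" for i n
      using sp es fs span_imp_lincomb[of "projl (a i (Vec, n))" "fs i @ es"] by (auto simp: Un_commute)
    then obtain ca where ca: "\<And>i n. i \<in> J \<Longrightarrow> (Vec, n) \<in> fm_vars \<phi> \<Longrightarrow> (Vec, n) \<in> X \<Longrightarrow>
        projl (a i (Vec, n)) = lincomb scale (fs i @ es) (ca i n)" by metis
    have "\<exists>c. (Vec, n) \<in> fm_vars \<phi> \<longrightarrow> (Vec, n) \<notin> X \<longrightarrow>
        projl (b I (Vec, n)) = lincomb scale (es @ gs I) c" for I n
      using G(4)[of I] es gs span_imp_lincomb[of "projl (b I (Vec, n))" "es @ gs I"]
      by (auto simp: Y_def VY_def)
    then have "\<forall>x. \<exists>c. (Vec, snd x) \<in> fm_vars \<phi> \<longrightarrow> (Vec, snd x) \<notin> X \<longrightarrow>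
        projl (b (fst x) (Vec, snd x)) = lincomb scale (es @ gs (fst x)) c" by blast
    from choice[OF this] obtain cb' where "\<forall>x. (Vec, snd x) \<in> fm_vars \<phi> \<longrightarrow> (Vec, snd x) \<notin> X \<longrightarrow>
        projl (b (fst x) (Vec, snd x)) = lincomb scale (es @ gs (fst x)) (cb' x)" ..
    then have cb: "projl (b I (Vec, n)) = lincomb scale (es @ gs I) (cb' (I, n))"
      if "(Vec, n) \<in> fm_vars \<phi>" "(Vec, n) \<notin> X" for I n
      using that by (metis fst_conv snd_conv)
    \<comment> \<open>Coordinates in the frame \<open>fs i @ es @ gs I\<close>: a i occupies the
      first r + D positions, b I those from r on. Although the frame depends on both i and I,
      \<open>a' i\<close> does not depend on I, nor \<open>b' I\<close> on i, as shattering
      requires.\<close>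
    define a' where "a' i x = (case x of VC n j \<Rightarrow> if j < r + D then ca i n j else 0
                               | SC n \<Rightarrow> projr (a i (Sca, n)))" for i x
    define b' where "b' I x = (case x of VC n j \<Rightarrow> if j < r then 0 else cb' (I, n) (j - r)
                               | SC n \<Rightarrow> projr (b I (Sca, n)))" for I x
    have key: "sat (vs_struct scale) (override_on (b I) (a i) X) \<phi> \<longleftrightarrow>
        P (r + D + card (G I)) (override_on (b' I) (a' i) XK)" if "good i I" "i \<in> J" "I \<subseteq> J" for i I
    proof -
      let ?bs = "fs i @ es @ gs I" and ?e = "override_on (b' I) (a' i) XK"
      have va: "a i \<in> valuations (vs_struct scale)" and vb: "b I \<in> valuations (vs_struct scale)"
        using sh that by (auto simp: shatters_def)
      have "override_on (b I) (a i) X v = frame_val scale ?bs ?e v" if v: "v \<in> fm_vars \<phi>" for v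
      proof -
        obtain n where "v = (Vec, n) \<or> v = (Sca, n)" using fst_snd_vs_cases by blast
        then show ?thesis
        proof
          assume vn: "v = (Vec, n)"
          show ?thesis
          proof (cases "v \<in> X")
            case True
            have "(\<lambda>j. ?e (VC n j)) = (\<lambda>j. if j < length (fs i @ es) then ca i n j else 0)"
              using True len \<open>i \<in> J\<close> by (auto simp: XK_def vn a'_def)
            then have "lincomb scale ?bs (\<lambda>j. ?e (VC n j)) = projl (a i v)"
              using lincomb_pad_right[OF vector_space_axioms, of "fs i @ es" "gs I" "ca i n"]
                ca[OF \<open>i \<in> J\<close>, of n] v True by (simp add: vn)
            then show ?thesis
              using True vs_valuationsD(1)[OF va, of n] by (simp add: vn frame_val_def)
          next
            case False
            have "(\<lambda>j. ?e (VC n j)) = (\<lambda>j. if j < length (fs i) then 0 else cb' (I, n)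
              (j - length (fs i)))"
              using False len \<open>i \<in> J\<close> by (auto simp: XK_def vn b'_def)
            then have "lincomb scale ?bs (\<lambda>j. ?e (VC n j)) = projl (b I v)"
              using lincomb_pad_left[OF vector_space_axioms, of "fs i" "es @ gs I" "cb' (I, n)"]
                cb[of n I] v False by (simp add: vn)
            then show ?thesis
              using False vs_valuationsD(1)[OF vb, of n] by (simp add: vn frame_val_def)
          qed
        next
          assume "v = (Sca, n)"
          then show ?thesis
            using vs_valuationsD(2)[OF va, of n] vs_valuationsD(2)[OF vb, of n]
            by (auto simp: frame_val_def XK_def a'_def b'_def override_on_def)
        qed
      qed
      then have "sat (vs_struct scale) (override_on (b I) (a i) X) \<phi> \<longleftrightarrow>
          sat (vs_struct scale) (frame_val scale ?bs ?e) \<phi>"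
        by (rule sat_cong)
      also have "\<dots> \<longleftrightarrow> P (length ?bs) ?e" by (rule P(2)[OF lin[OF that(1,2)]])
      also have "length ?bs = r + D + card (G I)" using len \<open>i \<in> J\<close> by simp
      finally show ?thesis .
    qed
    \<comment> \<open>\<open>T I\<close> consists of the indices that the field formula selects.
      Within J it differs from I only at exceptional indices.\<close>
    define T where "T I = {i. P (r + D + card (G I)) (override_on (b' I) (a' i) XK)}" for I
    have "card {i\<in>J. (i \<in> T I) \<noteq> (i \<in> I)} \<le> q" if "I \<subseteq> J" for I
    proof -
      have "{i\<in>J. (i \<in> T I) \<noteq> (i \<in> I)} \<subseteq> {i\<in>J. \<not> good i I}"
        using key sh that by (auto simp: T_def shatters_def)
      then have "card {i\<in>J. (i \<in> T I) \<noteq> (i \<in> I)} \<le> card {i\<in>J. \<not> good i I}"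
        using J(1) by (intro card_mono) auto
      then show ?thesis using few[of I] by linarith
    qed
    from approximate_shattering[OF J, of "\<lambda>I. card (G I)" T, OF cardG this]
    obtain c J' where c: "c \<le> q" "J' \<subseteq> J" "card J' = M"
      and cJ: "\<forall>I'\<subseteq>J'. \<exists>I\<subseteq>J. card (G I) = c \<and> T I \<inter> J' = I'" by blast
    then have "\<forall>I'. \<exists>I. I' \<subseteq> J' \<longrightarrow> card (G I) = c \<and> T I \<inter> J' = I'" by blast
    \<comment> \<open>For a subset I' of J', the set \<open>\<beta> I'\<close> belongs to the
      original family, its selection cuts out I' on J', and its frames have the common length r + D
      + c.\<close>
    then obtain \<beta> where \<beta>: "\<And>I'. I' \<subseteq> J' \<Longrightarrow> card (G (\<beta> I')) = c" "\<And>I'. I' \<subseteq> J' \<Longrightarrow> T (\<beta> I') \<inter> J' = I'"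
      by metis
    have "P (r + D + c) (override_on (b' (\<beta> I)) (a' i) XK) \<longleftrightarrow> i \<in> I" if "i \<in> J'" "I \<subseteq> J'" for i I
    proof -
      have "i \<in> I \<longleftrightarrow> i \<in> T (\<beta> I)" using \<beta>(2)[OF that(2)] that(1) by blast
      then show ?thesis using \<beta>(1)[OF that(2)] by (simp add: T_def)
    qed
    then have "shatters UNIV XK (P (r + D + c)) J' a' (\<lambda>I. b' (\<beta> I))"
      by (simp add: shatters_def)
    then show False
      using N[of J' c] NM[OF c(1)] c J(1) finite_subset by blast
  qed
qed

text \<open>
  Induction on the dimension of the tuples a i over a common space: a maximal subfamily that is
  independent over E either is large, or can be absorbed into E, lowering the dimension of the
  others.
\<close>

lemma shattering_bounded:
  fixes \<phi> :: "(vs_sort, vs_fun, unit) fm"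
  assumes nip: "nip field_lang (field_struct :: (unit, field_fun, unit, 'a) struc)"
    and wf: "wf_fm vs_lang \<phi>"
  shows "\<exists>m. \<forall>J a b E F. finite J \<longrightarrow> m \<le> card J \<longrightarrow> finite E \<longrightarrow> independent E \<longrightarrow> card E \<le> D \<longrightarrow>
     (\<forall>i\<in>J. finite (F i) \<and> card (F i) < r) \<longrightarrow>
     (\<forall>i\<in>J. \<forall>n. (Vec, n) \<in> fm_vars \<phi> \<and> (Vec, n) \<in> X \<longrightarrow> projl (a i (Vec, n)) \<in> span (E \<union> F i)) \<longrightarrow>
     \<not> shatters (valuations (vs_struct scale)) X (\<lambda>e. sat (vs_struct scale) e \<phi>) J a b"
proof (induction r arbitrary: D)
  case 0
  show ?case
  \<comment> \<open>A cardinality below 0 is impossible, so one index already gives a contradiction;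
    the strict bound on F makes the base case void.\<close>
  proof (intro exI[of _ 1] allI impI)
    fix J :: "nat set" and a b and E :: "'b set" and F :: "nat \<Rightarrow> 'b set"
    assume "finite J" "1 \<le> card J" and F: "\<forall>i\<in>J. finite (F i) \<and> card (F i) < 0"
    then have "J \<noteq> {}" by auto
    then show "\<not> shatters (valuations (vs_struct scale)) X (\<lambda>e. sat (vs_struct scale) e \<phi>) J a b"
      using F by auto
  qed
next
  case (Suc r)
  let ?sp = "\<lambda>J a E F. \<forall>i\<in>J. \<forall>n. (Vec, n) \<in> fm_vars \<phi> \<and> (Vec, n) \<in> X \<longrightarrow>
    projl ((a :: nat \<Rightarrow> vs_sort var \<Rightarrow> 'b + 'a) i (Vec, n)) \<in> span (E \<union> F i)"
  let ?sh = "shatters (valuations (vs_struct scale)) X (\<lambda>e. sat (vs_struct scale) e \<phi>)"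
  have "\<forall>D. \<exists>m. \<forall>J a b E F. finite J \<longrightarrow> m \<le> card J \<longrightarrow> finite E \<longrightarrow> card E = D \<longrightarrow>
     (\<forall>i\<in>J. finite (F i) \<and> card (F i) = r) \<longrightarrow> ?sp J a E F \<longrightarrow> independent_over scale E F J \<longrightarrow> \<not> ?sh J a b"
    using independent_family_bounded[OF nip wf] by blast
  then obtain m where m: "\<And>J a b E F. finite J \<Longrightarrow> m (card E) \<le> card J \<Longrightarrow> finite E \<Longrightarrow>
     (\<forall>i\<in>J. finite (F i) \<and> card (F i) = r) \<Longrightarrow> ?sp J a E F \<Longrightarrow> independent_over scale E F J \<Longrightarrow> \<not> ?sh J a b"
    by metis
  define M where "M = Max (m ` {..D})"
  have mM: "m d \<le> M" if "d \<le> D" for d unfolding M_def using that by (intro Max_ge) auto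
  \<comment> \<open>Absorbing fewer than M sets of size r into E adds at most M * r vectors, so the
    induction hypothesis is needed at a larger D.\<close>
  obtain N where N: "\<And>J a b E F. finite J \<Longrightarrow> N \<le> card J \<Longrightarrow> finite E \<Longrightarrow> independent E \<Longrightarrow> card E \<le> D + M * r \<Longrightarrow>
     (\<forall>i\<in>J. finite (F i) \<and> card (F i) < r) \<Longrightarrow> ?sp J a E F \<Longrightarrow> \<not> ?sh J a b"
    using Suc.IH[of "D + M * r"] by metis
  show ?case
  \<comment> \<open>Either the maximal independent subfamily K has at least M members, or at least N
    indices remain outside it.\<close>
  proof (intro exI[of _ "N + M"] allI impI notI)
    fix J :: "nat set" and a b and E :: "'b set" and F :: "nat \<Rightarrow> 'b set"
    assume J: "finite J" "N + M \<le> card J" and E: "finite E" "independent E" "card E \<le> D"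
      and F: "\<forall>i\<in>J. finite (F i) \<and> card (F i) < Suc r" and sp: "?sp J a E F" and sh: "?sh J a b"
    \<comment> \<open>Only indices with \<open>F i\<close> of full size r compete; the others
      already meet the bound of the induction hypothesis.\<close>
    define C where "C = {K. K \<subseteq> J \<and> (\<forall>i\<in>K. card (F i) = r) \<and> independent_over scale E F K}"
    have "finite C" unfolding C_def using J(1) by simp
    moreover have "{} \<in> C" using E(2) by (simp add: C_def independent_over_def)
    ultimately obtain K where K: "K \<in> C" "\<And>K'. K' \<in> C \<Longrightarrow> K \<subseteq> K' \<Longrightarrow> K = K'"
      using finite_has_maximal[of C] by blast
    have KJ: "K \<subseteq> J" and KF: "\<And>i. i \<in> K \<Longrightarrow> card (F i) = r" and ind: "independent_over scale E F K"
      using K(1) by (auto simp: C_def)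
    have finK: "finite K" using KJ J(1) finite_subset by blast
    have "card K < M"
    proof (rule ccontr)
      assume "\<not> card K < M"
      then have "m (card E) \<le> card K" using mM[OF E(3)] by simp
      moreover have "?sp K a E F" using sp KJ by blast
      ultimately have "\<not> ?sh K a b"
        using m[OF finK _ E(1) _ _ ind] F KF KJ by blast
      then show False using shatters_subset[OF sh KJ] by blast
    qed
    let ?E = "E \<union> \<Union> (F ` K)"
    have finE: "finite ?E" using E(1) finK F KJ by auto
    have indE: "independent ?E" using ind by (simp add: independent_over_def)
    have "card (\<Union> (F ` K)) \<le> (\<Sum>i\<in>K. card (F i))" by (rule card_UN_le[OF finK])
    also have "\<dots> = card K * r" using KF by simp
    also have "\<dots> \<le> M * r" using \<open>card K < M\<close> by simp
    finally have cardE: "card ?E \<le> D + M * r"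
      using card_Un_le[of E "\<Union> (F ` K)"] E(3) by linarith
    have "\<exists>F'. finite F' \<and> card F' < r \<and> F i \<subseteq> span (?E \<union> F')" if i: "i \<in> J - K" for i
    proof (cases "card (F i) = r")
      case True
      have "\<not> (?E \<inter> F i = {} \<and> independent (?E \<union> F i))"
      proof
        assume *: "?E \<inter> F i = {} \<and> independent (?E \<union> F i)"
        then have "independent_over scale E F (insert i K)"
          using ind by (auto simp: independent_over_def Un_ac)
        then have "insert i K \<in> C" using i True KJ KF by (auto simp: C_def)
        then show False using K(2)[of "insert i K"] i by blast
      qed
      moreover have "finite (F i)" using F i by blast
      ultimately obtain F' where "F' \<subseteq> F i" "card F' < card (F i)" "F i \<subseteq> span (?E \<union> F')"
        using reduce_relative_to[OF _ indE, of "F i"] by blast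
      then show ?thesis using True \<open>finite (F i)\<close> finite_subset by blast
    next
      case False
      then have "finite (F i) \<and> card (F i) < r" using F i by (auto simp: less_Suc_eq)
      moreover have "F i \<subseteq> span (?E \<union> F i)" by (auto intro: span_base)
      ultimately show ?thesis by blast
    qed
    then obtain F' where F': "\<And>i. i \<in> J - K \<Longrightarrow> finite (F' i) \<and> card (F' i) < r"
      "\<And>i. i \<in> J - K \<Longrightarrow> F i \<subseteq> span (?E \<union> F' i)" by metis
    have "?sp (J - K) a ?E F'"
    proof (intro ballI allI impI)
      fix i n assume i: "i \<in> J - K" and n: "(Vec, n) \<in> fm_vars \<phi> \<and> (Vec, n) \<in> X"
      have "E \<union> F i \<subseteq> span (?E \<union> F' i)" using F'(2)[OF i] by (auto intro: span_base)
      then have "span (E \<union> F i) \<subseteq> span (?E \<union> F' i)" by (rule span_minimal) (rule subspace_span)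
      then show "projl (a i (Vec, n)) \<in> span (?E \<union> F' i)" using sp i n by blast
    qed
    moreover have "N \<le> card (J - K)"
      using J \<open>card K < M\<close> KJ finK by (simp add: card_Diff_subset)
    ultimately have "\<not> ?sh (J - K) a b"
      using N[of "J - K" ?E F' a b] J(1) finE indE cardE F'(1) by blast
    then show False using shatters_subset[OF sh, of "J - K"] by blast
  qed
qed

lemma nip_vs_struct_if_nip_field:
  assumes "nip field_lang (field_struct :: (unit, field_fun, unit, 'a) struc)"
  shows "nip vs_lang (vs_struct scale)"
proof (rule nipI)
  fix \<phi> :: "(vs_sort, vs_fun, unit) fm" and X
  assume wf: "wf_fm vs_lang \<phi>"
  define V where "V = {n. (Vec, n) \<in> fm_vars \<phi> \<and> (Vec, n) \<in> X}"
  have finV: "finite V" unfolding V_def by (rule finite_index_set)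
  define F where "F a i = (\<lambda>n. projl ((a :: nat \<Rightarrow> vs_sort var \<Rightarrow> 'b + 'a) i (Vec, n))) ` V"
    for a and i :: nat
  \<comment> \<open>The induction starts with E empty, hence D = 0, and with F the set of vectors of
    a i itself.\<close>
  obtain m where m: "\<And>J a b E F. finite J \<Longrightarrow> m \<le> card J \<Longrightarrow> finite E \<Longrightarrow> independent E \<Longrightarrow> card E \<le> 0 \<Longrightarrow>
     (\<forall>i\<in>J. finite (F i) \<and> card (F i) < Suc (card V)) \<Longrightarrow>
     (\<forall>i\<in>J. \<forall>n. (Vec, n) \<in> fm_vars \<phi> \<and> (Vec, n) \<in> X \<longrightarrow> projl (a i (Vec, n)) \<in> span (E \<union> F i)) \<Longrightarrow>
     \<not> shatters (valuations (vs_struct scale)) X (\<lambda>e. sat (vs_struct scale) e \<phi>) J a b"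
    using shattering_bounded[OF assms wf, of 0 "Suc (card V)" X] by metis
  have "finite (F a i)" "card (F a i) < Suc (card V)" for a i
    using finV by (auto simp: F_def less_Suc_eq_le intro: card_image_le)
  moreover have "projl (a i (Vec, n)) \<in> span ({} \<union> F a i)"
    if "(Vec, n) \<in> fm_vars \<phi> \<and> (Vec, n) \<in> X" for a i n
    using that by (intro span_base) (auto simp: F_def V_def)
  ultimately have "\<not> shatters (valuations (vs_struct scale)) X (\<lambda>e. sat (vs_struct scale) e \<phi>) {..<m}
    a b" for a b
    by (intro m[of "{..<m}" "{}" "F a" a b]) (auto simp: independent_empty)
  then show "\<exists>n. \<forall>a b. \<not> shatters (valuations (vs_struct scale)) X (\<lambda>e. sat (vs_struct scale) e \<phi>)
    {..<n} a b"
    by blast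
qed

end

section \<open>Definability of the base field and of the expanded language\<close>

section \<open>Interpretations between fields and vector spaces\<close>

text \<open>Converse of \<open>definable_dfn\<close>. Variables are positions: those below
  \<open>length ss\<close> are the coordinates of the tuple, and the rest are frozen at d and become
  parameters.\<close>

lemma dfn_definable:
  fixes \<sigma> :: "nat \<Rightarrow> 's"
  assumes "dfn L M \<sigma> P" and \<sigma>: "\<And>i. i < length ss \<Longrightarrow> \<sigma> i = ss ! i"
    and d: "d \<in> vals M \<sigma>" and ne: "\<And>s. carrier M s \<noteq> {}"
  shows "definable L M ss {as \<in> tuples M ss. P (\<lambda>i. if i < length ss then as ! i else d i)}"
proof -
  obtain \<phi> g where \<phi>: "wf_fm L \<phi>" "sorted_subst M fst \<sigma> g"
    "\<And>e. e \<in> vals M \<sigma> \<Longrightarrow> P e \<longleftrightarrow> sat M (pull e g) \<phi>"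
    using assms(1) unfolding dfn_def by blast
  define arg where "arg v i \<longleftrightarrow> g v = Inl i \<and> i < length ss" for v i
  \<comment> \<open>Variables standing for coordinate i become the i-th coordinate variable; all
    others move beyond \<open>length ss\<close>, out of the reach of \<open>assign\<close>.\<close>
  define \<rho> where
    "\<rho> v = (if \<exists>i. arg v i then (fst v, THE i. arg v i) else (fst v, length ss + snd v))" for v
  have "fst \<circ> \<rho> = fst" by (auto simp: \<rho>_def)
  then obtain \<psi> where \<psi>: "wf_fm L \<psi>" "\<And>e. sat M e \<psi> \<longleftrightarrow> sat M (\<lambda>v. e (\<rho> v)) \<phi>"
    using ex_rename[OF \<phi>(1), of \<rho> M] by blast
  define p where "p v = (if snd v < length ss then SOME a. a \<in> carrier M (fst v)
    else pull d g (fst v, snd v - length ss))" for v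
  have "pull d g \<in> vals M fst" by (rule pull_vals[OF \<phi>(2) d])
  then have p: "p \<in> valuations M"
    using ne by (auto simp: vals_fst p_def valuations_def some_in_eq)
  have "sat M (assign ss as p) \<psi> \<longleftrightarrow> P (\<lambda>i. if i < length ss then as ! i else d i)"
    if as: "as \<in> tuples M ss" for as
  proof -
    let ?e = "\<lambda>i. if i < length ss then as ! i else d i"
    have "?e \<in> vals M \<sigma>"
      using as d \<sigma> by (auto simp: vals_def tuples_def list_all2_conv_all_nth)
    moreover have "assign ss as p (\<rho> v) = pull ?e g v" for v
    proof (cases "\<exists>i. arg v i")
      case True
      then obtain i where i: "g v = Inl i" "i < length ss" by (auto simp: arg_def)
      then have "(THE i. arg v i) = i" by (auto simp: arg_def)
      moreover have "ss ! i = fst v" using sorted_substD(1)[OF \<phi>(2) i(1)] \<sigma>[OF i(2)] by simp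
      ultimately show ?thesis using True i by (simp add: \<rho>_def assign_def pull_def)
    next
      case False
      then show ?thesis
        by (auto simp: \<rho>_def assign_def pull_def p_def arg_def split: sum.splits)
    qed
    ultimately show ?thesis by (simp add: \<psi>(2) \<phi>(3))
  qed
  then show ?thesis
    unfolding definable_def using \<psi>(1) p by (intro exI[of _ \<psi>] exI[of _ p]) auto
qed

lemma dfn_tm_eq:
  assumes "wf_tm L t s" "wf_tm L u s" "sorted_subst M fst \<sigma> g"
  shows "dfn L M \<sigma> (\<lambda>e. tm_val M (pull e g) t = tm_val M (pull e g) u)"
  unfolding dfn_def using assms by (intro exI[of _ "Eq t u"] exI[of _ g]) auto

lemma dfn_eq:
  assumes "\<sigma> x = \<sigma> y" and ne: "\<And>s. carrier M s \<noteq> {}"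
  shows "dfn L M \<sigma> (\<lambda>e. e x = e y)"
proof -
  define g where "g v = (if v = (\<sigma> x, 0) then Inl x else if v = (\<sigma> x, 1) then Inl y
    else Inr (SOME a. a \<in> carrier M (fst v)))" for v :: "'a var"
  have "sorted_subst M fst \<sigma> g"
    using assms by (intro sorted_substI) (auto simp: g_def some_in_eq split: if_splits)
  from dfn_tm_eq[OF wf_tm.intros(1) wf_tm.intros(1) this, of L "\<sigma> x" 0 1] show ?thesis
    by (simp add: pull_def g_def)
qed

lemma dfn_eq_const:
  assumes "a \<in> carrier M (\<sigma> x)" and ne: "\<And>s. carrier M s \<noteq> {}"
  shows "dfn L M \<sigma> (\<lambda>e. e x = a)"
proof -
  define g where "g v = (if v = (\<sigma> x, 0) then Inl x else if v = (\<sigma> x, 1) then Inr a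
    else Inr (SOME a. a \<in> carrier M (fst v)))" for v :: "'b var"
  have "sorted_subst M fst \<sigma> g"
    using assms by (intro sorted_substI) (auto simp: g_def some_in_eq split: if_splits)
  from dfn_tm_eq[OF wf_tm.intros(1) wf_tm.intros(1) this, of L "\<sigma> x" 0 1] show ?thesis
    by (simp add: pull_def g_def)
qed

lemma tuples_snoc:
  "as \<in> tuples M (ss @ [s]) \<longleftrightarrow> (\<exists>xs y. as = xs @ [y] \<and> xs \<in> tuples M ss \<and> y \<in> carrier M s)"
  unfolding tuples_def
proof
  assume "as \<in> {as. list_all2 (\<lambda>a s. a \<in> carrier M s) as (ss @ [s])}"
  then show "\<exists>xs y. as = xs @ [y] \<and> xs \<in> {as. list_all2 (\<lambda>a s. a \<in> carrier M s) as ss} \<and> y \<in>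
    carrier M s"
    by (auto simp: list_all2_append2 list_all2_Cons2)
qed (auto intro: list_all2_appendI)

lemma definable_graph:
  assumes f: "fsig L f = Some (ss, s)" and ne: "\<And>s. carrier M s \<noteq> {}"
  shows "definable L M (ss @ [s])
    {xs @ [y] | xs y. xs \<in> tuples M ss \<and> y \<in> carrier M s \<and> fint M f xs = y}"
proof -
  define t where "t = App f (map (\<lambda>i. Var (ss ! i, i)) [0..<length ss])"
  define p where "p v = (SOME a. a \<in> carrier M (fst v))" for v :: "'a var"
  have p: "p \<in> valuations M" using ne by (auto simp: p_def valuations_def some_in_eq)
  have "wf_tm L t s"
    unfolding t_def by (rule wf_tm.intros(2)[OF f]) (auto simp: list_all2_conv_all_nth intro:
      wf_tm.intros)
  then have wf: "wf_fm L (Eq t (Var (s, length ss)))" by (auto intro: wf_tm.intros)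
  have "sat M (assign (ss @ [s]) (xs @ [y]) p) (Eq t (Var (s, length ss))) \<longleftrightarrow> fint M f xs = y"
    if xs: "xs \<in> tuples M ss" for xs y
  proof -
    have len: "length xs = length ss" using xs by (auto simp: tuples_def dest: list_all2_lengthD)
    have "map (tm_val M (assign (ss @ [s]) (xs @ [y]) p)) (map (\<lambda>i. Var (ss ! i, i)) [0..<length ss])
      = xs"
      using len by (intro nth_equalityI) (auto simp: assign_def nth_append)
    then show ?thesis using len by (simp add: t_def assign_def nth_append comp_def)
  qed
  then have "{xs @ [y] | xs y. xs \<in> tuples M ss \<and> y \<in> carrier M s \<and> fint M f xs = y} =
      {as \<in> tuples M (ss @ [s]). sat M (assign (ss @ [s]) as p) (Eq t (Var (s, length ss)))}"
    by (auto simp: tuples_snoc simp del: sat.simps)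
  then show ?thesis unfolding definable_def using wf p by blast
qed

lemma map2_const_left: "length xs = length ys \<Longrightarrow> map2 (\<lambda>_. g) xs ys = map g ys"
  by (intro nth_equalityI) auto

text \<open>When each sort of N is in bijection with a single sort of M, codes have length one and
  equality pulls back to equality, so only graphs and relations remain to be defined. All three
  interpretations below have this form.\<close>

lemma interpretable_sortwise:
  fixes \<tau> :: "'t \<Rightarrow> 's" and \<eta> :: "'t \<Rightarrow> 'a \<Rightarrow> 'b"
  assumes ne: "\<And>s. carrier M s \<noteq> {}"
    and bij: "\<And>t. bij_betw (\<eta> t) (carrier M (\<tau> t)) (carrier N t)"
    and graph: "\<And>f ts t. fsig L' f = Some (ts, t) \<Longrightarrow> definable L M (map \<tau> ts @ [\<tau> t])
       {xs @ [y] | xs y. xs \<in> tuples M (map \<tau> ts) \<and> y \<in> carrier M (\<tau> t) \<and> fint N f (map2 \<eta> ts xs) =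
         \<eta> t y}"
    and rel: "\<And>r ts. rsig L' r = Some ts \<Longrightarrow> definable L M (map \<tau> ts)
       {xs \<in> tuples M (map \<tau> ts). rint N r (map2 \<eta> ts xs)}"
  shows "interpretable_in L' N L M"
proof -
  define D where "D t = {[a] | a. a \<in> carrier M (\<tau> t)}" for t
  define h where "h t x = \<eta> t (hd x)" for t and x :: "'a list"
  define p where "p v = (SOME a. a \<in> carrier M (fst v))" for v :: "'s var"
  have p: "p \<in> valuations M" using ne by (auto simp: p_def valuations_def some_in_eq)
  have tup1: "tuples M [s] = {[a] | a. a \<in> carrier M s}" for s
    by (auto simp: tuples_def list_all2_Cons2)
  have "definable L M [\<tau> t] (D t)" for t
    unfolding definable_def D_def
    by (intro exI[of _ "Eq (Var (\<tau> t, 0)) (Var (\<tau> t, 0))"] exI[of _ p])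
      (auto simp: tup1 p intro: wf_tm.intros)
  moreover have "h t ` D t = carrier N t" for t
  proof -
    have "D t = (\<lambda>a. [a]) ` carrier M (\<tau> t)" by (auto simp: D_def)
    then show ?thesis using bij[of t] by (simp add: h_def image_image bij_betw_def)
  qed
  moreover have "definable L M ([\<tau> t] @ [\<tau> t]) {x @ y | x y. x \<in> D t \<and> y \<in> D t \<and> h t x = h t y}" for t
  proof -
    have "{x @ y | x y. x \<in> D t \<and> y \<in> D t \<and> h t x = h t y} =
        {as \<in> tuples M ([\<tau> t] @ [\<tau> t]). as ! 0 = as ! 1}"
      (is "?K = ?E")
    proof (intro equalityI subsetI)
      fix as assume "as \<in> ?K"
      then obtain a b where ab: "as = [a, b]" "a \<in> carrier M (\<tau> t)" "b \<in> carrier M (\<tau> t)" "\<eta> t a =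
        \<eta> t b"
        unfolding D_def h_def by force
      then have "a = b" using bij[of t] unfolding bij_betw_def by (blast dest: inj_onD)
      then show "as \<in> ?E" using ab by (simp add: tuples_def)
    next
      fix as assume "as \<in> ?E"
      then obtain a where "as = [a] @ [a]" "a \<in> carrier M (\<tau> t)"
        by (auto simp: tuples_def list_all2_Cons2)
      then show "as \<in> ?K" unfolding D_def by blast
    qed
    then show ?thesis
      unfolding definable_def
      by (intro exI[of _ "Eq (Var (\<tau> t, 0)) (Var (\<tau> t, 1))"] exI[of _ p])
        (auto simp: assign_def p intro: wf_tm.intros)
  qed
  \<comment> \<open>Lists of one-element codes correspond to plain tuples.\<close>
  moreover have D_list: "(\<exists>xs. as = concat xs \<and> list_all2 (\<lambda>x u. x \<in> D u) xs ts \<and> Q (map2 h ts xs)) \<longleftrightarrow>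
      as \<in> tuples M (map \<tau> ts) \<and> Q (map2 \<eta> ts as)" for as ts Q
  proof -
    have "list_all2 (\<lambda>x u. x \<in> D u) xs ts \<longleftrightarrow> (\<exists>as\<in>tuples M (map \<tau> ts). xs = map (\<lambda>a. [a]) as)" for xs
    proof
      assume "list_all2 (\<lambda>x u. x \<in> D u) xs ts"
      then have len: "length xs = length ts" and
        ex: "\<And>i. i < length ts \<Longrightarrow> \<exists>a. xs ! i = [a] \<and> a \<in> carrier M (\<tau> (ts ! i))"
        by (auto simp: list_all2_conv_all_nth D_def)
      have "hd (xs ! i) \<in> carrier M (\<tau> (ts ! i))" "xs ! i = [hd (xs ! i)]" if "i < length ts" for i
        using ex[OF that] by auto
      then have "map hd xs \<in> tuples M (map \<tau> ts)" "xs = map (\<lambda>a. [a]) (map hd xs)"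
        using len by (auto simp: list_all2_conv_all_nth tuples_def intro!: nth_equalityI)
      then show "\<exists>as\<in>tuples M (map \<tau> ts). xs = map (\<lambda>a. [a]) as" by blast
    qed (auto simp: list_all2_conv_all_nth tuples_def D_def)
    moreover have "concat (map (\<lambda>a. [a]) as) = as" for as :: "'a list" by (induction as) auto
    moreover have "map2 h ts (map (\<lambda>a. [a]) as) = map2 \<eta> ts as" for as
      by (auto simp: h_def zip_map2 comp_def split_beta)
    moreover have "(\<exists>xs. as = concat xs \<and> (\<exists>bs\<in>tuples M (map \<tau> ts). xs = map (\<lambda>a. [a]) bs) \<and>
      Q (map2 h ts xs)) \<longleftrightarrow>
        (\<exists>bs\<in>tuples M (map \<tau> ts). as = concat (map (\<lambda>a. [a]) bs) \<and> Q (map2 h ts (map (\<lambda>a. [a]) bs)))"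
      by blast
    ultimately show ?thesis by simp
  qed
  have cm: "concat (map (\<lambda>t. [\<tau> t]) ts) = map \<tau> ts" for ts by (induction ts) auto
  have "definable L M (concat (map (\<lambda>t. [\<tau> t]) ts) @ [\<tau> t])
     {concat xs @ y | xs y. list_all2 (\<lambda>x u. x \<in> D u) xs ts \<and> y \<in> D t \<and> fint N f (map2 h ts xs) =
       h t y}"
    if "fsig L' f = Some (ts, t)" for f ts t
  proof -
    have eq: "(\<exists>xs. u = concat xs \<and> list_all2 (\<lambda>x u. x \<in> D u) xs ts \<and> fint N f (map2 h ts xs) = h t y) \<longleftrightarrow>
        u \<in> tuples M (map \<tau> ts) \<and> fint N f (map2 \<eta> ts u) = h t y" for u y
      by (rule D_list)
    have D_ex: "(\<exists>y\<in>D t. P y) \<longleftrightarrow> (\<exists>a\<in>carrier M (\<tau> t). P [a])" for P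
      by (auto simp: D_def)
    have "{concat xs @ y | xs y. list_all2 (\<lambda>x u. x \<in> D u) xs ts \<and> y \<in> D t \<and> fint N f (map2 h ts xs) =
      h t y} =
      {z. \<exists>y\<in>D t. \<exists>u. z = u @ y \<and>
        (\<exists>xs. u = concat xs \<and> list_all2 (\<lambda>x u. x \<in> D u) xs ts \<and> fint N f (map2 h ts xs) = h t y)}"
      by blast
    also have "\<dots> = {xs @ [y] | xs y. xs \<in> tuples M (map \<tau> ts) \<and> y \<in> carrier M (\<tau> t) \<and>
      fint N f (map2 \<eta> ts xs) = \<eta> t y}"
      unfolding eq D_ex unfolding h_def list.sel by blast
    finally show ?thesis using graph[OF that] by (simp add: cm)
  qed
  moreover have "definable L M (concat (map (\<lambda>t. [\<tau> t]) ts))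
     {concat xs | xs. list_all2 (\<lambda>x u. x \<in> D u) xs ts \<and> rint N r (map2 h ts xs)}"
    if "rsig L' r = Some ts" for r ts
  proof -
    have "{concat xs | xs. list_all2 (\<lambda>x u. x \<in> D u) xs ts \<and> rint N r (map2 h ts xs)} =
      {as. \<exists>xs. as = concat xs \<and> list_all2 (\<lambda>x u. x \<in> D u) xs ts \<and> rint N r (map2 h ts xs)}" by blast
    then show ?thesis using rel[OF that] D_list[of _ ts "rint N r"] by (simp add: cm)
  qed
  ultimately show ?thesis
    unfolding interpretable_in_def
    by (intro exI[of _ "\<lambda>t. [\<tau> t]"] exI[of _ D] exI[of _ h]) blast
qed

lemma vs_carrier_nonempty: "vs_carrier s \<noteq> {}"
  by (cases s) auto

lemma vs_op_closed: "vs_op scale f xs \<in> vs_carrier (snd (vs_fsig f))"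
  by (cases f) auto

lemma vsW_struct_simps [simp]:
  "carrier (vsW_struct scale) = vs_carrier" "fint (vsW_struct scale) = vsW_op scale"
  "rint (vsW_struct scale) = (\<lambda>_ xs. lin_indep_tuple scale (map projl xs))"
  by (simp_all add: vsW_struct_def)

lemma is_structure_field: "is_structure field_lang field_struct"
  by (simp add: is_structure_def)

lemma is_structure_vs: "is_structure vs_lang (vs_struct scale)"
proof -
  have "vs_op scale f as \<in> vs_carrier s" if "vs_fsig f = (ss, s)" for f as ss s
    using vs_op_closed[of scale f as] that by simp
  then show ?thesis by (simp add: is_structure_def vs_carrier_nonempty vs_lang_def)
qed

lemma is_structure_vsW: "is_structure vsW_lang (vsW_struct scale)"
proof -
  have "vsW_op scale f as \<in> vs_carrier s" if "vsW_fsig f = Some (ss, s)" for f as ss s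
  proof (cases f)
    case (Base f')
    then show ?thesis using vs_op_closed[of scale f' as] that by simp
  next
    case (Lambda n i)
    then show ?thesis using that by (auto split: if_splits)
  qed
  then show ?thesis by (simp add: is_structure_def vs_carrier_nonempty vsW_lang_def)
qed

lemma field_interpretable_in_vs:
  "interpretable_in field_lang (field_struct :: (unit, field_fun, unit, 'k::field) struc)
     vs_lang (vs_struct (scale :: 'k \<Rightarrow> 'v::ab_group_add \<Rightarrow> 'v))"
proof (rule interpretable_sortwise[where \<tau> = "\<lambda>_. Sca" and \<eta> = "\<lambda>_. projr"])
  show "bij_betw projr (carrier (vs_struct scale) Sca) (carrier field_struct t)" for t
    by (auto simp: bij_betw_def inj_on_def image_image)
  fix f ts t
  assume "fsig field_lang f = Some (ts, t)"
  then have ts: "ts = replicate (field_arity f) ()" by (simp add: field_lang_def)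
  have "fsig vs_lang (Fld f) = Some (map (\<lambda>_. Sca) ts, Sca)"
    by (simp add: vs_lang_def ts map_replicate_const)
  then have "definable vs_lang (vs_struct scale) (map (\<lambda>_. Sca) ts @ [Sca])
     {xs @ [y] | xs y. xs \<in> tuples (vs_struct scale) (map (\<lambda>_. Sca) ts) \<and> y \<in>
       carrier (vs_struct scale) Sca \<and>
        fint (vs_struct scale) (Fld f) xs = y}"
    by (rule definable_graph) (simp add: vs_carrier_nonempty)
  moreover have "fint (vs_struct scale) (Fld f) xs = y \<longleftrightarrow> fint field_struct f (map2 (\<lambda>_. projr) ts xs)
    = projr y"
    if "xs \<in> tuples (vs_struct scale) (map (\<lambda>_. Sca) ts)" "y \<in> carrier (vs_struct scale) Sca" for xs y
  proof -
    have "length ts = length xs" using that(1) by (auto simp: tuples_def dest: list_all2_lengthD)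
    then show ?thesis using that(2) by (auto simp: map2_const_left)
  qed
  ultimately show "definable vs_lang (vs_struct scale) (map (\<lambda>_. Sca) ts @ [Sca])
     {xs @ [y] | xs y. xs \<in> tuples (vs_struct scale) (map (\<lambda>_. Sca) ts) \<and> y \<in>
       carrier (vs_struct scale) Sca \<and>
        fint field_struct f (map2 (\<lambda>_. projr) ts xs) = projr y}"
    by (smt (verit) Collect_cong)
qed (auto simp: vs_carrier_nonempty field_lang_def)

lemma vs_interpretable_in_vsW:
  "interpretable_in vs_lang (vs_struct scale) vsW_lang (vsW_struct scale)"
proof (rule interpretable_sortwise[where \<tau> = "\<lambda>s. s" and \<eta> = "\<lambda>_ x. x"])
  fix f ts t
  assume "fsig vs_lang f = Some (ts, t)"
  then have "fsig vsW_lang (Base f) = Some (ts, t)" by (simp add: vs_lang_def vsW_lang_def)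
  then have "definable vsW_lang (vsW_struct scale) (ts @ [t])
     {xs @ [y] | xs y. xs \<in> tuples (vsW_struct scale) ts \<and> y \<in> carrier (vsW_struct scale) t \<and>
        fint (vsW_struct scale) (Base f) xs = y}"
    by (rule definable_graph) (simp add: vs_carrier_nonempty)
  moreover have "fint (vsW_struct scale) (Base f) xs = fint (vs_struct scale) f (map2 (\<lambda>_ x. x) ts xs)"
    if "xs \<in> tuples (vsW_struct scale) ts" for xs
  proof -
    have "length ts = length xs" using that by (auto simp: tuples_def dest: list_all2_lengthD)
    then show ?thesis by (simp add: map2_const_left)
  qed
  ultimately show "definable vsW_lang (vsW_struct scale) (map (\<lambda>s. s) ts @ [t])
     {xs @ [y] | xs y. xs \<in> tuples (vsW_struct scale) (map (\<lambda>s. s) ts) \<and> y \<in>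
       carrier (vsW_struct scale) t \<and>
        fint (vs_struct scale) f (map2 (\<lambda>_ x. x) ts xs) = y}"
    by (smt (verit) Collect_cong list.map_ident)
qed (auto simp: vs_carrier_nonempty vs_lang_def bij_betw_def)

section \<open>Linear independence and coordinate functions in the language of vector spaces\<close>

primrec lincomb_tm :: "nat \<Rightarrow> (vs_sort, vs_fun) tm" where
  "lincomb_tm 0 = App VZero []"
| "lincomb_tm (Suc n) = App VAdd [lincomb_tm n, App Scal [Var (Sca, n), Var (Vec, n)]]"

lemma wf_lincomb_tm: "wf_tm vs_lang (lincomb_tm n) Vec"
proof (induction n)
  case 0
  then show ?case by (auto intro!: wf_tm.intros(2) simp: vs_lang_def)
next
  case (Suc n)
  have "wf_tm vs_lang (App Scal [Var (Sca, n), Var (Vec, n)]) Vec"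
    by (auto intro!: wf_tm.intros simp: vs_lang_def)
  then show ?case using Suc by (auto intro!: wf_tm.intros(2) simp: vs_lang_def)
qed

lemma tm_val_lincomb_tm:
  "tm_val (vs_struct scale) e (lincomb_tm n) =
   Inl (lincomb scale (map (\<lambda>j. projl (e (Vec, j))) [0..<n]) (\<lambda>j. projr (e (Sca, j))))"
  by (induction n) (simp_all add: lincomb_snoc)

text \<open>The value y is a variable or a constant: the test for independence compares with the
  constant 0, the coordinate functions with a variable.\<close>

lemma dfn_lincomb_eq:
  assumes "\<And>j. j < n \<Longrightarrow> \<sigma> (vx j) = Vec" and "\<And>j. j < n \<Longrightarrow> \<sigma> (cx j) = Sca"
    and y: "case y of Inl x \<Rightarrow> \<sigma> x = Vec | Inr a \<Rightarrow> a \<in> range Inl"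
  shows "dfn vs_lang (vs_struct scale) \<sigma> (\<lambda>e.
    Inl (lincomb scale (map (\<lambda>j. projl (e (vx j))) [0..<n]) (\<lambda>j. projr (e (cx j)))) = case_sum e id y)"
proof -
  \<comment> \<open>\<open>lincomb_tm n\<close> uses indices below n only, so the variable
    \<open>(Vec, n)\<close> is free to hold the value y.\<close>
  define g where "g v = (case fst v of
      Vec \<Rightarrow> if snd v < n then Inl (vx (snd v)) else y
    | Sca \<Rightarrow> if snd v < n then Inl (cx (snd v)) else Inr (Inr 0))" for v
  have "sorted_subst (vs_struct scale) fst \<sigma> g"
  proof (rule sorted_substI)
    show "\<sigma> x = fst v" if "g v = Inl x" for v x
      using that assms by (cases "fst v") (auto simp: g_def split: if_splits)
    show "a \<in> carrier (vs_struct scale) (fst v)" if "g v = Inr a" for v a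
      using that assms by (cases "fst v") (auto simp: g_def split: if_splits)
  qed
  from dfn_tm_eq[OF wf_lincomb_tm wf_tm.intros(1) this, of n n]
  have "dfn vs_lang (vs_struct scale) \<sigma> (\<lambda>e. Inl (lincomb scale
      (map (\<lambda>j. projl (pull e g (Vec, j))) [0..<n]) (\<lambda>j. projr (pull e g (Sca, j)))) =
        pull e g (Vec, n))"
    by (simp add: tm_val_lincomb_tm)
  moreover have "lincomb scale (map (\<lambda>j. projl (pull e g (Vec, j))) [0..<n])
    (\<lambda>j. projr (pull e g (Sca, j))) =
      lincomb scale (map (\<lambda>j. projl (e (vx j))) [0..<n]) (\<lambda>j. projr (e (cx j)))" for e
    by (auto simp: lincomb_def pull_def g_def intro!: sum.cong)
  moreover have "pull e g (Vec, n) = case_sum e id y" for e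
    by (simp add: pull_def g_def split: sum.split)
  ultimately show ?thesis by simp
qed

definition set_scalars :: "(nat \<Rightarrow> 'x) \<Rightarrow> nat \<Rightarrow> (nat \<Rightarrow> 'k) \<Rightarrow> ('x \<Rightarrow> 'v + 'k) \<Rightarrow> 'x \<Rightarrow> 'v + 'k" where
  "set_scalars cx n c e x = (if x \<in> cx ` {..<n} then Inr (c (inv_into {..<n} cx x)) else e x)"

lemma set_scalars_simps:
  shows "inj_on cx {..<n} \<Longrightarrow> j < n \<Longrightarrow> set_scalars cx n c e (cx j) = Inr (c j)"
    and "(\<And>j. j < n \<Longrightarrow> x \<noteq> cx j) \<Longrightarrow> set_scalars cx n c e x = e x"
  by (auto simp: set_scalars_def)

text \<open>Turns a block of quantifiers over the scalar variables \<open>cx j\<close> into one over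
  coefficient functions, the form in which facts about \<open>lincomb\<close> are stated.
  Injectivity lets the coefficients vary independently.\<close>

lemma ex_scalars_iff:
  assumes e: "e \<in> vals (vs_struct scale) \<sigma>"
    and cx: "\<And>j. j < n \<Longrightarrow> \<sigma> (cx j) = Sca" and inj: "inj_on cx {..<n}"
  shows "(\<exists>f \<in> vals (vs_struct scale) \<sigma>. R (override_on e f (cx ` {..<n}))) \<longleftrightarrow>
    (\<exists>c. R (set_scalars cx n c e))"
proof
  assume "\<exists>f \<in> vals (vs_struct scale) \<sigma>. R (override_on e f (cx ` {..<n}))"
  then obtain f where f: "f \<in> vals (vs_struct scale) \<sigma>" "R (override_on e f (cx ` {..<n}))" by blast
  have "f (cx j) \<in> range Inr" if "j < n" for j
    using f(1) cx[OF that] by (simp add: vals_def) (metis vs_carrier.simps(2))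
  then have "f (cx j) = Inr (projr (f (cx j)))" if "j < n" for j using that by fastforce
  then have "override_on e f (cx ` {..<n}) = set_scalars cx n (\<lambda>j. projr (f (cx j))) e"
    using inj by (auto simp: fun_eq_iff override_on_def set_scalars_def)
  then show "\<exists>c. R (set_scalars cx n c e)" using f(2) by metis
next
  assume "\<exists>c. R (set_scalars cx n c e)"
  then obtain c where c: "R (set_scalars cx n c e)" by blast
  have "set_scalars cx n c e x \<in> vs_carrier (\<sigma> x)" for x
    using e cx by (auto simp: set_scalars_def vals_def)
  then have "set_scalars cx n c e \<in> vals (vs_struct scale) \<sigma>" by (simp add: vals_def)
  moreover have "override_on e (set_scalars cx n c e) (cx ` {..<n}) = set_scalars cx n c e"
    by (auto simp: fun_eq_iff override_on_def set_scalars_def)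
  ultimately show "\<exists>f \<in> vals (vs_struct scale) \<sigma>. R (override_on e f (cx ` {..<n}))"
    using c by metis
qed

context vector_space
begin

text \<open>The auxiliary scalars \<open>cx\<close> are quantified away: a tuple is dependent if
  some coefficients, not all zero, combine it to 0. Their sort keeps them apart from the vector
  variables \<open>vx\<close>.\<close>

lemma dfn_lin_indep:
  assumes vx: "\<And>j. j < n \<Longrightarrow> \<sigma> (vx j) = Vec" and cx: "\<And>j. j < n \<Longrightarrow> \<sigma> (cx j) = Sca"
    and inj: "inj_on cx {..<n}"
  shows "dfn vs_lang (vs_struct scale) \<sigma> (\<lambda>e. lin_indep_tuple scale (map (\<lambda>j. projl (e (vx j)))
    [0..<n]))"
proof -
  define B where "B e \<longleftrightarrow>
     Inl (lincomb scale (map (\<lambda>j. projl (e (vx j))) [0..<n]) (\<lambda>j. projr (e (cx j)))) =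
       case_sum e id (Inr (Inl 0)) \<and>
     \<not> (\<forall>j\<in>{..<n}. e (cx j) = Inr 0)" for e :: "_ \<Rightarrow> 'b + 'a"
  have "dfn vs_lang (vs_struct scale) \<sigma> B"
    unfolding B_def[abs_def]
    by (intro dfn_conj dfn_neg dfn_all_finite dfn_lincomb_eq dfn_eq_const vx cx)
      (auto simp: cx vs_carrier_nonempty)
  then have "dfn vs_lang (vs_struct scale) \<sigma>
      (\<lambda>e. \<not> (\<exists>f\<in>vals (vs_struct scale) \<sigma>. B (override_on e f (cx ` {..<n}))))"
    by (intro dfn_neg dfn_ex_set) (auto simp: vs_carrier_nonempty)
  then show ?thesis
  proof (rule dfn_cong)
    fix e assume e: "e \<in> vals (vs_struct scale) \<sigma>"
    have "set_scalars cx n c e (vx j) = e (vx j)" if "j < n" for c j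
      using vx[OF that] cx by (intro set_scalars_simps(2)) auto
    then have "B (set_scalars cx n c e) \<longleftrightarrow>
        lincomb scale (map (\<lambda>j. projl (e (vx j))) [0..<n]) c = 0 \<and> \<not> (\<forall>j<n. c j = 0)" for c
      using inj by (auto simp: B_def set_scalars_simps lincomb_def)
    moreover have "(\<exists>f\<in>vals (vs_struct scale) \<sigma>. B (override_on e f (cx ` {..<n}))) \<longleftrightarrow>
        (\<exists>c. B (set_scalars cx n c e))"
      by (rule ex_scalars_iff) (simp_all add: e cx inj)
    ultimately show "\<not> (\<exists>f\<in>vals (vs_struct scale) \<sigma>. B (override_on e f (cx ` {..<n}))) \<longleftrightarrow>
        lin_indep_tuple scale (map (\<lambda>j. projl (e (vx j))) [0..<n])"
      unfolding lin_indep_iff_lincomb by auto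
  qed
qed

lemma representation_lincomb:
  assumes "lin_indep_tuple scale bs" and "j < length bs"
  shows "representation (set bs) (lincomb scale bs c) (bs ! j) = c j"
proof -
  have ind: "independent (set bs)" and dist: "distinct bs"
    using assms(1) by (auto simp: lin_indep_tuple_def)
  have "representation (set bs) (lincomb scale bs c) (bs ! j) =
      (\<Sum>k<length bs. representation (set bs) (scale (c k) (bs ! k)) (bs ! j))"
    unfolding lincomb_def using ind
    by (subst representation_sum) (auto intro!: span_scale intro: span_base)
  also have "\<dots> = (\<Sum>k<length bs. if k = j then c k else 0)"
    using ind dist assms(2)
    by (intro sum.cong refl)
      (auto simp: representation_scale representation_basis span_base nth_eq_iff_index_eq)
  also have "\<dots> = c j" using assms(2) by simp
  finally show ?thesis .
qed

text \<open>Uniqueness of coefficients turns the function value into an existential statement,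
  first-order for fixed length. The last clause is the default value 0 for both degenerate cases.
  The index is \<open>Suc i\<close> because \<open>coord\<close> counts from 1.\<close>

lemma coord_iff:
  assumes "i < length bs"
  shows "coord scale (Suc i) v bs = k \<longleftrightarrow>
    (lin_indep_tuple scale bs \<and> (\<exists>c. lincomb scale bs c = v \<and> c i = k)) \<or>
    (k = 0 \<and> \<not> (lin_indep_tuple scale bs \<and> (\<exists>c. lincomb scale bs c = v)))"
proof (cases "lin_indep_tuple scale bs \<and> (\<exists>c. lincomb scale bs c = v)")
  case True
  then obtain c where c: "lincomb scale bs c = v" by blast
  then have "coord scale (Suc i) v bs = c i"
    using True assms representation_lincomb[of bs i c] by (simp add: coord_def)
  moreover have "c' i = c i" if "lincomb scale bs c' = v" for c'
    using True assms c that lincomb_eq_iff[of bs c' c] by simp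
  then have "(\<exists>c. lincomb scale bs c = v \<and> c i = k) \<longleftrightarrow> c i = k"
    using c by metis
  ultimately show ?thesis using True by simp
next
  case False
  have "coord scale (Suc i) v bs = 0"
  proof (cases "lin_indep_tuple scale bs")
    case True
    then have "v \<notin> span (set bs)" using False span_imp_lincomb[of v bs] by metis
    then show ?thesis by (simp add: coord_def representation_def)
  qed (simp add: coord_def)
  then show ?thesis using False by auto
qed

text \<open>The result variable z is itself a scalar, so its sort does not separate it from the
  auxiliary \<open>cx\<close>, which are quantified away; the hypothesis on z does.\<close>

lemma dfn_coord:
  assumes vx: "\<And>j. j < n \<Longrightarrow> \<sigma> (vx j) = Vec" and cx: "\<And>j. j < n \<Longrightarrow> \<sigma> (cx j) = Sca"
    and inj: "inj_on cx {..<n}"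
    and y: "\<sigma> y = Vec" and z: "\<sigma> z = Sca" "\<And>j. j < n \<Longrightarrow> cx j \<noteq> z" and i: "i < n"
  shows "dfn vs_lang (vs_struct scale) \<sigma>
    (\<lambda>e. Inr (coord scale (Suc i) (projl (e y)) (map (\<lambda>j. projl (e (vx j))) [0..<n])) = e z)"
proof -
  define LI where "LI e \<longleftrightarrow> lin_indep_tuple scale (map (\<lambda>j. projl (e (vx j))) [0..<n])"
    for e :: "_ \<Rightarrow> 'b + 'a"
  define A where "A e \<longleftrightarrow>
     Inl (lincomb scale (map (\<lambda>j. projl (e (vx j))) [0..<n]) (\<lambda>j. projr (e (cx j)))) =
       case_sum e id (Inl y)" for e :: "_ \<Rightarrow> 'b + 'a"
  define B where "B e \<longleftrightarrow> A e \<and> e (cx i) = e z" for e :: "_ \<Rightarrow> 'b + 'a"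
  let ?ex = "\<lambda>R e. \<exists>f\<in>vals (vs_struct scale) \<sigma>. R (override_on e f (cx ` {..<n}))"
  have ne: "carrier (vs_struct scale) s \<noteq> {}" for s by (simp add: vs_carrier_nonempty)
  have LI: "dfn vs_lang (vs_struct scale) \<sigma> LI"
    unfolding LI_def[abs_def] by (rule dfn_lin_indep[where cx = cx]) (simp_all add: vx cx inj)
  have A: "dfn vs_lang (vs_struct scale) \<sigma> A"
    unfolding A_def[abs_def] by (rule dfn_lincomb_eq) (simp_all add: vx cx y)
  have B: "dfn vs_lang (vs_struct scale) \<sigma> B"
    unfolding B_def[abs_def] by (rule dfn_conj[OF A dfn_eq]) (simp_all add: cx[OF i] z
      vs_carrier_nonempty)
  have Z: "dfn vs_lang (vs_struct scale) \<sigma> (\<lambda>e. e z = Inr 0)"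
    by (rule dfn_eq_const) (simp_all add: z vs_carrier_nonempty)
  have "dfn vs_lang (vs_struct scale) \<sigma> (\<lambda>e. (LI e \<and> ?ex B e) \<or> (e z = Inr 0 \<and> \<not> (LI e \<and> ?ex A e)))"
    by (rule dfn_disj[OF dfn_conj[OF LI dfn_ex_set[OF _ B ne]]
          dfn_conj[OF Z dfn_neg[OF dfn_conj[OF LI dfn_ex_set[OF _ A ne]]]]]) simp_all
  then show ?thesis
  proof (rule dfn_cong)
    fix e assume e: "e \<in> vals (vs_struct scale) \<sigma>"
    let ?bs = "map (\<lambda>j. projl (e (vx j))) [0..<n]"
    have "e y \<in> range Inl" "e z \<in> range Inr"
      using e y z(1) by (simp_all add: vals_def) (metis vs_carrier.simps)+
    then obtain v k where vk: "e y = Inl v" "e z = Inr k" by blast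
    have "set_scalars cx n c e (vx j) = e (vx j)" if "j < n" for c j
      using vx[OF that] cx by (intro set_scalars_simps(2)) auto
    moreover have "set_scalars cx n c e y = e y" for c
      using y cx by (intro set_scalars_simps(2)) auto
    moreover have zz: "set_scalars cx n c e z = e z" for c
      using z by (intro set_scalars_simps(2)) auto
    ultimately have 1: "A (set_scalars cx n c e) \<longleftrightarrow> lincomb scale ?bs c = v" for c
      using inj vk by (auto simp: A_def set_scalars_simps lincomb_def)
    then have 2: "B (set_scalars cx n c e) \<longleftrightarrow> lincomb scale ?bs c = v \<and> c i = k" for c
      using inj vk i by (auto simp: B_def set_scalars_simps zz)
    have ex: "?ex R e \<longleftrightarrow> (\<exists>c. R (set_scalars cx n c e))" for R
      by (rule ex_scalars_iff) (simp_all add: e cx inj)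
    show "(LI e \<and> ?ex B e) \<or> (e z = Inr 0 \<and> \<not> (LI e \<and> ?ex A e)) \<longleftrightarrow>
        Inr (coord scale (Suc i) (projl (e y)) ?bs) = e z"
      unfolding ex[of A] ex[of B] 1 2 LI_def using coord_iff[of i ?bs v k] i vk by simp
  qed
qed

lemma vsW_interpretable_in_vs:
  "interpretable_in vsW_lang (vsW_struct scale) vs_lang (vs_struct scale)"
proof (rule interpretable_sortwise[where \<tau> = "\<lambda>s. s" and \<eta> = "\<lambda>_ x. x"])
  have len: "length xs = length ss" if "xs \<in> tuples (vs_struct scale) ss" for xs ss
    using that by (auto simp: tuples_def dest: list_all2_lengthD)
  have map2_id: "map2 (\<lambda>_ x. x) ss xs = xs" if "xs \<in> tuples (vs_struct scale) ss" for xs ss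
    using len[OF that] by (simp add: map2_const_left)
  have ne: "carrier (vs_struct scale) s \<noteq> {}" for s by (simp add: vs_carrier_nonempty)
  show "carrier (vs_struct scale) s \<noteq> {}" for s by (rule ne)
  show "bij_betw (\<lambda>x. x) (carrier (vs_struct scale) t) (carrier (vsW_struct scale) t)" for t
    by (simp add: bij_betw_def)
  fix f ts t
  assume f: "fsig vsW_lang f = Some (ts, t)"
  have "definable vs_lang (vs_struct scale) (ts @ [t])
     {xs @ [y] | xs y. xs \<in> tuples (vs_struct scale) ts \<and> y \<in> vs_carrier t \<and> vsW_op scale f xs = y}"
  proof (cases f)
    case (Base f')
    then have "fsig vs_lang f' = Some (ts, t)" using f by (simp add: vsW_lang_def vs_lang_def)
    from definable_graph[OF this ne] show ?thesis by (simp add: Base)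
  next
    case (Lambda n i)
    then have i: "1 \<le> i" "i \<le> n" and ts: "ts = replicate (Suc n) Vec" "t = Sca"
      using f by (auto simp: vsW_lang_def split: if_splits)
    \<comment> \<open>Position 0 is the vector to be expanded, positions 1 to n are the tuple, n + 1
      is the value, and the auxiliary scalars start at n + 2.\<close>
    define \<sigma> where "\<sigma> p = (if p \<le> n then Vec else Sca)" for p
    define d :: "nat \<Rightarrow> 'b + 'a" where "d p = (if p \<le> n then Inl 0 else Inr 0)" for p
    define G where "G e \<longleftrightarrow>
      Inr (coord scale (Suc (i - 1)) (projl (e 0)) (map (\<lambda>j. projl (e (Suc j))) [0..<n])) = e (Suc n)"
        for e
    define pad where "pad as p = (if p < length (ts @ [t]) then as ! p else d p)" for as p
    have "dfn vs_lang (vs_struct scale) \<sigma> G"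
      unfolding G_def[abs_def]
      by (rule dfn_coord[where cx = "\<lambda>j. n + 2 + j"]) (use i in \<open>auto simp: \<sigma>_def inj_on_def\<close>)
    then have "definable vs_lang (vs_struct scale) (ts @ [t])
        {as \<in> tuples (vs_struct scale) (ts @ [t]). G (pad as)}"
      unfolding pad_def[abs_def]
      by (rule dfn_definable) (auto simp: ts \<sigma>_def d_def vals_def vs_carrier_nonempty nth_append
        nth_Cons' less_Suc_eq)
    moreover have "G (pad (xs @ [y])) \<longleftrightarrow> vsW_op scale f xs = y"
      if xs_ts: "xs \<in> tuples (vs_struct scale) ts" for xs y
    proof -
      obtain v vs where xs: "xs = v # vs" "length vs = n"
        using len[OF xs_ts] by (cases xs) (auto simp: ts)
      have "map (\<lambda>j. projl (pad (xs @ [y]) (Suc j))) [0..<n] = map projl vs"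
        using xs by (intro nth_equalityI) (auto simp: pad_def ts nth_append)
      then show ?thesis using xs i by (simp add: G_def pad_def Lambda ts nth_append)
    qed
    then have "{as \<in> tuples (vs_struct scale) (ts @ [t]). G (pad as)} =
      {xs @ [y] | xs y. xs \<in> tuples (vs_struct scale) ts \<and> y \<in> vs_carrier t \<and> vsW_op scale f xs = y}"
      by (auto simp: tuples_snoc)
    ultimately show ?thesis by simp
  qed
  then show "definable vs_lang (vs_struct scale) (map (\<lambda>s. s) ts @ [t])
     {xs @ [y] | xs y. xs \<in> tuples (vs_struct scale) (map (\<lambda>s. s) ts) \<and> y \<in> carrier (vs_struct scale)
       t \<and>
        fint (vsW_struct scale) f (map2 (\<lambda>_ x. x) ts xs) = y}"
    by (simp add: map2_id cong: conj_cong)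
next
  fix r ts
  assume "rsig vsW_lang r = Some ts"
  then obtain n where ts: "ts = replicate n Vec" by (cases r) (auto simp: vsW_lang_def)
  define \<sigma> where "\<sigma> p = (if p < n then Vec else Sca)" for p
  define d :: "nat \<Rightarrow> 'b + 'a" where "d p = (if p < n then Inl 0 else Inr 0)" for p
  have "dfn vs_lang (vs_struct scale) \<sigma> (\<lambda>e. lin_indep_tuple scale (map (\<lambda>j. projl (e j)) [0..<n]))"
    by (rule dfn_lin_indep[where cx = "\<lambda>j. n + j"]) (auto simp: \<sigma>_def inj_on_def)
  then have "definable vs_lang (vs_struct scale) ts {as \<in> tuples (vs_struct scale) ts.
      (\<lambda>e. lin_indep_tuple scale (map (\<lambda>j. projl (e j)) [0..<n])) (\<lambda>p.
        if p < length ts then as ! p else d p)}"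
    by (rule dfn_definable) (auto simp: ts \<sigma>_def d_def vals_def vs_carrier_nonempty)
  moreover have "map (\<lambda>j. projl (if j < length ts then as ! j else d j)) [0..<n] =
    map projl (map2 (\<lambda>_ x. x) ts as)"
    if "as \<in> tuples (vs_struct scale) ts" for as
  proof -
    have "length as = n" using that ts by (auto simp: tuples_def dest: list_all2_lengthD)
    then show ?thesis by (intro nth_equalityI) (auto simp: ts)
  qed
  ultimately show "definable vs_lang (vs_struct scale) (map (\<lambda>s. s) ts)
     {xs \<in> tuples (vs_struct scale) (map (\<lambda>s. s) ts). rint (vsW_struct scale) r (map2 (\<lambda>_ x. x) ts xs)}"
    by (simp cong: conj_cong)
qed

end

section \<open>NIP for vector spaces\<close>

theorem corollary1p7:
  fixes scale :: "'k::field \<Rightarrow> 'v::ab_group_add \<Rightarrow> 'v"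
  assumes "vector_space scale"
  shows "(nip vs_lang (vs_struct scale) \<longleftrightarrow>
            nip field_lang (field_struct :: (unit, field_fun, unit, 'k) struc)) \<and>
         (nip vsW_lang (vsW_struct scale) \<longleftrightarrow>
            nip field_lang (field_struct :: (unit, field_fun, unit, 'k) struc)) \<and>
         (\<forall>(L :: ('s, 'f, 'r) language) (N :: ('s, 'f, 'r, 'a) struc).
            is_structure L N \<and> mutually_interpretable L N vs_lang (vs_struct scale) \<longrightarrow>
            (nip L N \<longleftrightarrow>
               nip field_lang (field_struct :: (unit, field_fun, unit, 'k) struc)))"
proof -
  interpret vector_space scale by (rule assms)
  let ?K = "field_struct :: (unit, field_fun, unit, 'k) struc"
  have ne: "carrier (vs_struct scale) s \<noteq> {}" "carrier (vsW_struct scale) s \<noteq> {}" for s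
    by (simp_all add: vs_carrier_nonempty)
  have K: "nip vs_lang (vs_struct scale) \<longleftrightarrow> nip field_lang ?K"
    using nip_interpretable[OF field_interpretable_in_vs is_structure_field ne(1)]
      nip_vs_struct_if_nip_field by blast
  moreover have "nip vsW_lang (vsW_struct scale) \<longleftrightarrow> nip vs_lang (vs_struct scale)"
    using nip_interpretable[OF vsW_interpretable_in_vs is_structure_vsW ne(1)]
      nip_interpretable[OF vs_interpretable_in_vsW is_structure_vs ne(2)] by blast
  moreover have "nip L N \<longleftrightarrow> nip vs_lang (vs_struct scale)"
    if "is_structure L N" "mutually_interpretable L N vs_lang (vs_struct scale)"
    for L :: "('s, 'f, 'r) language" and N :: "('s, 'f, 'r, 'a) struc"
  proof -
    have int: "interpretable_in L N vs_lang (vs_struct scale)" "interpretable_in vs_lang (vs_struct scale) L N"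
      using that(2) by (simp_all add: mutually_interpretable_def)
    \<comment> \<open>Transfer from N back to the vector space needs default elements in every sort
      of N.\<close>
    have "carrier N s \<noteq> {}" for s using that(1) by (simp add: is_structure_def)
    then show ?thesis
      using nip_interpretable[OF int(1) that(1) ne(1)] nip_interpretable[OF int(2) is_structure_vs] by blast
  qed
  ultimately show ?thesis by blast
qed

end
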